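(* In the setting of the context, assume that $\sum_{k\ge 0}\|\mathbb{E}(X_k\mid\mathcal{F}_0)\|_2^2<\infty$. If the series $\sum_{k=0}^\infty P_0(X_k)$ converges in $\mathbb{L}^2$ and $$\lim_{N\to\infty}\mathbb{E}\left(\sup_{k\ge N}\left|\sum_{i=k}^\infty P_0(X_i)\right|^2\right)=0,$$ then the $\mathbb{L}^2_0$-MA property holds. Moreover, the random variable $D$ in that property is $D=\sum_{k=0}^\infty P_0(X_k)$.
   Context: Let $(\Omega,\mathcal{A},\mathbb{P})$ be a probability space and $T:\Omega\to\Omega$ a bijective bimeasurable transformation preserving $\mathbb{P}$. Let $\mathcal{F}_0\subseteq\mathcal{A}$ be a $\sigma$-algebra with $\mathcal{F}_0\subseteq T^{-1}(\mathcal{F}_0)$, and let $\mathcal{F}_i=T^{-i}(\mathcal{F}_0)$ for $i\in\mathbb{Z}$. Let $X_0$ be an $\mathcal{F}_0$-measurable, square integrable, centered real random variable, $X_i=X_0\circ T^i$ for $i\in\mathbb{Z}$, and $S_n=X_1+\cdots+X_n$. Write $\|\cdot\|_2$ for the norm of $\mathbb{L}^2(\mathbb{P})$ and $P_0(X_k)=\mathbb{E}(X_k\mid\mathcal{F}_0)-\mathbb{E}(X_k\mid\mathcal{F}_{-1})$. The $\mathbb{L}^2_0$-MA property (martingale approximation in $\mathbb{L}^2(\mathcal{F}_0)$) means: there exists a (necessarily unique) $\mathcal{F}_0$-measurable random variable $D\in\mathbb{L}^2$ such that $\mathbb{E}(D\circ T\mid\mathcal{F}_0)=0$ a.s. and $$\lim_{n\to\infty}\frac1n\,\mathbb{E}\left(\Big(S_n-\sum_{k=1}^nD\circ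 T^k\Big)^2\,\Big|\,\mathcal{F}_0\right)=0\quad\text{almost surely and in }\mathbb{L}^1.$$ *)

theory Defs
  imports "HOL-Probability.Probability"
begin

text \<open>
  Integer iterates \<open>T\<^sup>i\<close> of a bijection \<open>T\<close> of the set \<open>\<Omega>\<close>. The inverse is taken relative
  to \<open>\<Omega>\<close>, since \<open>T\<close> need not be injective on the whole type.
\<close>

definition iter :: "'a set \<Rightarrow> ('a \<Rightarrow> 'a) \<Rightarrow> int \<Rightarrow> 'a \<Rightarrow> 'a" where
  "iter \<Omega> T i = (if 0 \<le> i then T ^^ nat i else the_inv_into \<Omega> T ^^ nat (- i))"

definition bimeasurable_bij :: "'a measure \<Rightarrow> ('a \<Rightarrow> 'a) \<Rightarrow> bool" where
  "bimeasurable_bij M T \<longleftrightarrow>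
     bij_betw T (space M) (space M) \<and> T \<in> M \<rightarrow>\<^sub>M M \<and> the_inv_into (space M) T \<in> M \<rightarrow>\<^sub>M M"

text \<open>
  A sub-\<open>\<sigma>\<close>-algebra is represented, as in the theory of conditional expectations, by a measure
  whose measure values are irrelevant.
\<close>

definition filt :: "'a measure \<Rightarrow> ('a \<Rightarrow> 'a) \<Rightarrow> 'a measure \<Rightarrow> int \<Rightarrow> 'a measure" where
  "filt M T F0 i = vimage_algebra (space M) (iter (space M) T i) F0"

definition proc :: "'a measure \<Rightarrow> ('a \<Rightarrow> 'a) \<Rightarrow> ('a \<Rightarrow> real) \<Rightarrow> int \<Rightarrow> 'a \<Rightarrow> real" where
  "proc M T X0 i = (\<lambda>x. X0 (iter (space M) T i x))"

definition proj0 ::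
  "'a measure \<Rightarrow> ('a \<Rightarrow> 'a) \<Rightarrow> 'a measure \<Rightarrow> ('a \<Rightarrow> real) \<Rightarrow> 'a \<Rightarrow> real" where
  "proj0 M T F0 Y =
     (\<lambda>x. real_cond_exp M F0 Y x - real_cond_exp M (filt M T F0 (- 1)) Y x)"

definition in_L2 :: "'a measure \<Rightarrow> ('a \<Rightarrow> real) \<Rightarrow> bool" where
  "in_L2 M f \<longleftrightarrow> f \<in> borel_measurable M \<and> integrable M (\<lambda>x. (f x)\<^sup>2)"

text \<open>Only meaningful for \<open>f\<close> in \<open>L\<^sup>2\<close>: outside, the Bochner integral is \<open>0\<close> by convention.\<close>

definition L2_norm :: "'a measure \<Rightarrow> ('a \<Rightarrow> real) \<Rightarrow> real" where
  "L2_norm M f = sqrt (\<integral>x. (f x)\<^sup>2 \<partial>M)"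

definition L2_sums :: "'a measure \<Rightarrow> (nat \<Rightarrow> 'a \<Rightarrow> real) \<Rightarrow> ('a \<Rightarrow> real) \<Rightarrow> bool" where
  "L2_sums M f s \<longleftrightarrow>
     (\<forall>n. in_L2 M (f n)) \<and> in_L2 M s \<and>
     (\<lambda>n. L2_norm M (\<lambda>x. (\<Sum>i<n. f i x) - s x)) \<longlonglongrightarrow> 0"

definition L2_summable :: "'a measure \<Rightarrow> (nat \<Rightarrow> 'a \<Rightarrow> real) \<Rightarrow> bool" where
  "L2_summable M f \<longleftrightarrow> (\<exists>s. L2_sums M f s)"

text \<open>
  The sum of an \<open>L\<^sup>2\<close>-convergent series is only determined up to a null set; this picks an
  arbitrary representative.
\<close>

definition L2_suminf :: "'a measure \<Rightarrow> (nat \<Rightarrow> 'a \<Rightarrow> real) \<Rightarrow> 'a \<Rightarrow> real" where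
  "L2_suminf M f = (SOME s. L2_sums M f s)"

definition ma_error ::
  "'a measure \<Rightarrow> ('a \<Rightarrow> 'a) \<Rightarrow> 'a measure \<Rightarrow> ('a \<Rightarrow> real) \<Rightarrow> ('a \<Rightarrow> real) \<Rightarrow> nat \<Rightarrow> 'a \<Rightarrow> real" where
  "ma_error M T F0 X0 D n =
     (\<lambda>x. 1 / real n * real_cond_exp M F0
        (\<lambda>y. ((\<Sum>k=1..n. proc M T X0 (int k) y) - (\<Sum>k=1..n. D (iter (space M) T (int k) y)))\<^sup>2) x)"

definition is_L2_0_MA ::
  "'a measure \<Rightarrow> ('a \<Rightarrow> 'a) \<Rightarrow> 'a measure \<Rightarrow> ('a \<Rightarrow> real) \<Rightarrow> ('a \<Rightarrow> real) \<Rightarrow> bool" where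
  "is_L2_0_MA M T F0 X0 D \<longleftrightarrow>
     D \<in> borel_measurable F0 \<and> in_L2 M D \<and>
     (AE x in M. real_cond_exp M F0 (\<lambda>y. D (T y)) x = 0) \<and>
     (AE x in M. (\<lambda>n. ma_error M T F0 X0 D n x) \<longlonglongrightarrow> 0) \<and>
     (\<lambda>n. \<integral>x. \<bar>ma_error M T F0 X0 D n x\<bar> \<partial>M) \<longlonglongrightarrow> 0"

definition L2_0_MA ::
  "'a measure \<Rightarrow> ('a \<Rightarrow> 'a) \<Rightarrow> 'a measure \<Rightarrow> ('a \<Rightarrow> real) \<Rightarrow> bool" where
  "L2_0_MA M T F0 X0 \<longleftrightarrow> (\<exists>D. is_L2_0_MA M T F0 X0 D)"

end

theory Submission
  imports Defs
begin

text \<open>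
  Write \<open>Q g = \<E>(g \<circ> T | F)\<close> with \<open>F = F0\<close>, and \<open>a\<^sub>k = \<E>(X\<^sub>k | F)\<close>. Moving the conditioning by \<open>T\<close> turns
  the definition of the projections \<open>p\<^sub>k = P\<^sub>0(X\<^sub>k)\<close> into \<open>p\<^sub>k \<circ> T = a\<^sub>k \<circ> T - a\<^bsub>k+1\<^esub>\<close>
  (\<open>cond_exp_pullback\<close>). These increments telescope along the triangle \<open>i + j \<le> n\<close>
  (\<open>triangular_telescoping\<close>), so with the tails \<open>R\<^sub>k = D - (p\<^sub>0 + \<dots> + p\<^bsub>k-1\<^esub>)\<close> one gets the exact formula
  \<open>S\<^sub>n - \<Sum>i=1..n. D \<circ> T\<^sup>i = (\<Sum>m=1..n. a\<^sub>m) - (\<Sum>i=1..n. R\<^bsub>n+1-i\<^esub> \<circ> T\<^sup>i)\<close>.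

  The first sum is \<open>F\<close>-measurable. Since \<open>\<Sum>k. a\<^sub>k\<^sup>2\<close> is integrable, hence almost surely finite, its square is
  \<open>o(n)\<close> almost surely, and in \<open>L\<^sup>1\<close> by dominated convergence (\<open>square_sum_Cesaro_AE_L1\<close>).

  The second sum consists of martingale differences, because \<open>\<E>(R\<^sub>k \<circ> T | F) = 0\<close>. Its conditional second
  moment is therefore \<open>\<Sum>i=1..n. \<E>(R\<^bsub>n+1-i\<^esub>\<^sup>2 \<circ> T\<^sup>i | F)\<close> (\<open>CE_martingale_square\<close>). The hypothesis on the
  suprema says that, for every \<open>\<epsilon>\<close>, all \<open>R\<^sub>k\<^sup>2\<close> with large \<open>k\<close> lie below one function \<open>h\<close> of integral at most
  \<open>\<epsilon>\<close>; the finitely many other \<open>R\<^sub>k\<^sup>2\<close> lie below \<open>h + A\<close> for a constant \<open>A\<close>, after an enlargement of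
  \<open>h\<close> of small integral, and their number does not grow with \<open>n\<close>. Up to \<open>O(1/n)\<close> the averages are thus bounded by
  those of \<open>\<E>(h \<circ> T\<^sup>i | F)\<close>, and the maximal inequality for the positive operator \<open>Q\<close>
  (\<open>maximal_ergodic_inequality\<close>) makes their supremum small in probability. This yields convergence almost
  surely (\<open>cesaro_CE_AE\<close>) without appealing to a pointwise ergodic theorem.

  Two martingales that both approximate \<open>S\<^sub>n\<close> differ by a martingale with stationary increments, whose second
  moment is exactly \<open>n\<close> times that of one increment (\<open>integral_martingale_square\<close>). Both errors being
  \<open>o(n)\<close>, the increments agree (\<open>martingale_approximation_unique\<close>), and this identifies \<open>D\<close>.
\<close>

section \<open>Square integrable functions\<close>

lemma power2_diff_le: "(a - b)\<^sup>2 \<le> 2 * a\<^sup>2 + 2 * b\<^sup>2" for a b :: real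
  using zero_le_power2[of "a + b"] by (simp add: power2_eq_square algebra_simps)

lemma in_L2_cmult:
  assumes "in_L2 M f"
  shows "in_L2 M (\<lambda>x. c * f x)"
  using assms unfolding in_L2_def by (auto simp: power_mult_distrib)

lemma in_L2_add:
  assumes f: "in_L2 M f" and g: "in_L2 M g"
  shows "in_L2 M (\<lambda>x. f x + g x)"
  unfolding in_L2_def
proof
  have [measurable]: "f \<in> borel_measurable M" "g \<in> borel_measurable M"
    using f g by (auto simp: in_L2_def)
  show "(\<lambda>x. f x + g x) \<in> borel_measurable M"
    by measurable
  have "integrable M (\<lambda>x. 2 * (f x)\<^sup>2 + 2 * (g x)\<^sup>2)"
    using f g by (auto simp: in_L2_def)
  then show "integrable M (\<lambda>x. (f x + g x)\<^sup>2)"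
  proof (rule Bochner_Integration.integrable_bound)
    have "(f x + g x)\<^sup>2 \<le> 2 * (f x)\<^sup>2 + 2 * (g x)\<^sup>2" for x
      using power2_diff_le[of "f x" "- g x"] by simp
    then show "AE x in M. norm ((f x + g x)\<^sup>2) \<le> norm (2 * (f x)\<^sup>2 + 2 * (g x)\<^sup>2)"
      by (intro AE_I2) (auto intro: order_trans[OF _ abs_ge_self])
  qed measurable
qed

lemma in_L2_diff:
  assumes "in_L2 M f" "in_L2 M g"
  shows "in_L2 M (\<lambda>x. f x - g x)"
  using in_L2_add[OF assms(1) in_L2_cmult[OF assms(2), of "-1"]] by simp

lemma in_L2_sum:
  assumes "\<And>i. i \<in> I \<Longrightarrow> in_L2 M (f i)"
  shows "in_L2 M (\<lambda>x. \<Sum>i\<in>I. f i x)"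
  using assms
  by (induction I rule: infinite_finite_induct) (auto intro: in_L2_add simp: in_L2_def[of _ "\<lambda>x. 0"])

lemma in_L2_mult_integrable:
  assumes f: "in_L2 M f" and g: "in_L2 M g"
  shows "integrable M (\<lambda>x. f x * g x)"
proof -
  have [measurable]: "f \<in> borel_measurable M" "g \<in> borel_measurable M"
    using f g by (auto simp: in_L2_def)
  have "integrable M (\<lambda>x. (f x)\<^sup>2 + (g x)\<^sup>2)"
    using f g by (auto simp: in_L2_def)
  then show ?thesis
  proof (rule Bochner_Integration.integrable_bound)
    have "\<bar>f x * g x\<bar> \<le> (f x)\<^sup>2 + (g x)\<^sup>2" for x
    proof -
      have "2 * \<bar>f x * g x\<bar> \<le> (f x)\<^sup>2 + (g x)\<^sup>2"
        using sum_squares_bound[of "\<bar>f x\<bar>" "\<bar>g x\<bar>"] by (simp add: abs_mult)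
      then show ?thesis
        using abs_ge_zero[of "f x * g x"] by linarith
    qed
    then show "AE x in M. norm (f x * g x) \<le> norm ((f x)\<^sup>2 + (g x)\<^sup>2)"
      by (intro AE_I2) (auto intro: order_trans[OF _ abs_ge_self])
  qed measurable
qed

context prob_space
begin

lemma in_L2_integrable: "in_L2 M f \<Longrightarrow> integrable M f"
  unfolding in_L2_def using square_integrable_imp_integrable by blast

lemma L1_norm_le_L2_norm:
  assumes "in_L2 M f"
  shows "(\<integral>x. \<bar>f x\<bar> \<partial>M) \<le> L2_norm M f"
proof -
  have "0 \<le> variance (\<lambda>x. \<bar>f x\<bar>)"
    by (rule variance_positive)
  also have "\<dots> = (\<integral>x. (f x)\<^sup>2 \<partial>M) - (\<integral>x. \<bar>f x\<bar> \<partial>M)\<^sup>2"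
    using assms in_L2_integrable[OF assms] by (subst variance_eq) (auto simp: in_L2_def)
  finally show ?thesis
    unfolding L2_norm_def by (intro real_le_rsqrt) simp
qed

text \<open>
  This is how almost-everywhere identities are passed through the \<open>L\<^sup>2\<close>-convergent series below.
\<close>

lemma AE_eq_if_L1_limit_eq:
  fixes f g :: "'a \<Rightarrow> real"
  assumes f: "integrable M f" and g: "integrable M g" and u: "\<And>n. integrable M (u n)"
    and uf: "(\<lambda>n. \<integral>x. \<bar>u n x - f x\<bar> \<partial>M) \<longlonglongrightarrow> 0"
    and ug: "(\<lambda>n. \<integral>x. \<bar>u n x - g x\<bar> \<partial>M) \<longlonglongrightarrow> 0"
  shows "AE x in M. f x = g x"
proof -
  have "(\<integral>x. \<bar>f x - g x\<bar> \<partial>M) \<le> (\<integral>x. \<bar>u n x - f x\<bar> \<partial>M) + (\<integral>x. \<bar>u n x - g x\<bar> \<partial>M)" for n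
  proof -
    have "(\<integral>x. \<bar>f x - g x\<bar> \<partial>M) \<le> (\<integral>x. \<bar>u n x - f x\<bar> + \<bar>u n x - g x\<bar> \<partial>M)"
      using f g u by (intro integral_mono) auto
    also have "\<dots> = (\<integral>x. \<bar>u n x - f x\<bar> \<partial>M) + (\<integral>x. \<bar>u n x - g x\<bar> \<partial>M)"
      using f g u by (intro Bochner_Integration.integral_add) auto
    finally show ?thesis .
  qed
  then have "(\<integral>x. \<bar>f x - g x\<bar> \<partial>M) \<le> 0 + 0"
    by (intro LIMSEQ_le_const[OF tendsto_add[OF uf ug]]) auto
  moreover have "0 \<le> (\<integral>x. \<bar>f x - g x\<bar> \<partial>M)"
    by simp
  ultimately have "(\<integral>x. \<bar>f x - g x\<bar> \<partial>M) = 0"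
    by linarith
  then have "AE x in M. \<bar>f x - g x\<bar> = 0"
    using f g by (subst (asm) integral_nonneg_eq_0_iff_AE) auto
  then show ?thesis
    by simp
qed

lemma L2_sums_imp_L1:
  assumes "L2_sums M f s"
  shows "(\<lambda>n. \<integral>x. \<bar>(\<Sum>i<n. f i x) - s x\<bar> \<partial>M) \<longlonglongrightarrow> 0"
proof (rule tendsto_sandwich[OF _ _ tendsto_const])
  show "(\<lambda>n. L2_norm M (\<lambda>x. (\<Sum>i<n. f i x) - s x)) \<longlonglongrightarrow> 0"
    using assms by (simp add: L2_sums_def)
  have "in_L2 M (\<lambda>x. (\<Sum>i<n. f i x) - s x)" for n
    using assms by (intro in_L2_diff in_L2_sum) (auto simp: L2_sums_def)
  then show "\<forall>\<^sub>F n in sequentially. (\<integral>x. \<bar>(\<Sum>i<n. f i x) - s x\<bar> \<partial>M) \<le> L2_norm M (\<lambda>x. (\<Sum>i<n. f i x) - s x)"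
    by (intro always_eventually allI L1_norm_le_L2_norm)
qed auto

lemma L2_sums_unique_AE:
  assumes "L2_sums M f s" "L2_sums M f t"
  shows "AE x in M. s x = t x"
proof (rule AE_eq_if_L1_limit_eq[where u = "\<lambda>n x. \<Sum>i<n. f i x"])
  show "integrable M (\<lambda>x. \<Sum>i<n. f i x)" for n
    using assms by (intro in_L2_integrable in_L2_sum) (auto simp: L2_sums_def)
qed (use assms L2_sums_imp_L1 in \<open>auto simp: L2_sums_def in_L2_integrable\<close>)

lemma L2_sums_L2_suminf: "L2_summable M f \<Longrightarrow> L2_sums M f (L2_suminf M f)"
  unfolding L2_summable_def L2_suminf_def by (rule someI_ex[of "L2_sums M f"])

lemma L2_sums_tail:
  assumes "L2_sums M f s"
  shows "L2_sums M (\<lambda>i. f (k + i)) (\<lambda>x. s x - (\<Sum>i<k. f i x))"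
proof -
  have split: "(\<Sum>i<n. f (k + i) x) - (s x - (\<Sum>i<k. f i x)) = (\<Sum>i<n + k. f i x) - s x" for n x
    by (induction n) (auto simp: add.commute)
  have "(\<lambda>n. L2_norm M (\<lambda>x. (\<Sum>i<n + k. f i x) - s x)) \<longlonglongrightarrow> 0"
    using assms LIMSEQ_ignore_initial_segment unfolding L2_sums_def by blast
  then show ?thesis
    using assms unfolding L2_sums_def split by (auto intro!: in_L2_diff in_L2_sum)
qed

text \<open>
  The representatives chosen for the sums of the different tails are unrelated to each other, but by
  uniqueness of limits each one agrees almost everywhere with the tail of any given sum.
\<close>

lemma L2_suminf_tail_AE:
  assumes "L2_sums M f s"
  shows "AE x in M. L2_suminf M (\<lambda>i. f (k + i)) x = s x - (\<Sum>i<k. f i x)"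
  using L2_sums_tail[OF assms] L2_sums_L2_suminf L2_sums_unique_AE L2_summable_def by blast

end

lemma L2_sums_cong_AE:
  assumes s: "L2_sums M f s" and t: "t \<in> borel_measurable M" and eq: "AE x in M. t x = s x"
  shows "L2_sums M f t"
proof -
  have [measurable]: "s \<in> borel_measurable M" "f i \<in> borel_measurable M" for i
    using s by (auto simp: L2_sums_def in_L2_def)
  note t [measurable]
  have "integrable M (\<lambda>x. (s x)\<^sup>2)"
    using s by (simp add: L2_sums_def in_L2_def)
  moreover have "AE x in M. (s x)\<^sup>2 = (t x)\<^sup>2"
    using eq by eventually_elim simp
  ultimately have "integrable M (\<lambda>x. (t x)\<^sup>2)"
    by (subst integrable_cong_AE[where g = "\<lambda>x. (s x)\<^sup>2"]) (auto elim: eventually_mono)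
  moreover have "L2_norm M (\<lambda>x. (\<Sum>i<n. f i x) - t x) = L2_norm M (\<lambda>x. (\<Sum>i<n. f i x) - s x)" for n
    unfolding L2_norm_def
    using eq by (intro arg_cong[where f = sqrt] integral_cong_AE) (auto elim: eventually_mono)
  ultimately show ?thesis
    using s t by (simp add: L2_sums_def in_L2_def)
qed

lemma (in prob_space) cond_exp_L1_contraction:
  assumes F: "subalgebra M F" and f: "integrable M f" and g: "integrable M g"
  shows "(\<integral>x. \<bar>real_cond_exp M F f x - real_cond_exp M F g x\<bar> \<partial>M) \<le> (\<integral>x. \<bar>f x - g x\<bar> \<partial>M)"
proof -
  interpret finite_measure_subalgebra M F
    by unfold_locales (rule F)
  have int: "integrable M (\<lambda>x. f x - g x)"
    using f g by simp
  have "AE x in M. real_cond_exp M F (\<lambda>x. f x - g x) x = real_cond_exp M F f x - real_cond_exp M F g x"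
    using f g by (rule real_cond_exp_diff)
  moreover have "AE x in M. \<bar>real_cond_exp M F (\<lambda>x. f x - g x) x\<bar> \<le> real_cond_exp M F (\<lambda>x. \<bar>f x - g x\<bar>) x"
    using int convex_on_dist[of UNIV "0 :: real"]
    by (intro real_cond_exp_jensens_inequality(2)[where I = UNIV and q = abs]) (auto simp: dist_real_def)
  ultimately have "AE x in M. \<bar>real_cond_exp M F f x - real_cond_exp M F g x\<bar> \<le> real_cond_exp M F (\<lambda>x. \<bar>f x - g x\<bar>) x"
    by eventually_elim simp
  then have "(\<integral>x. \<bar>real_cond_exp M F f x - real_cond_exp M F g x\<bar> \<partial>M) \<le> (\<integral>x. real_cond_exp M F (\<lambda>x. \<bar>f x - g x\<bar>) x \<partial>M)"
    by (intro integral_mono_AE integrable_abs Bochner_Integration.integrable_diff real_cond_exp_int f g)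
  also have "\<dots> = (\<integral>x. \<bar>f x - g x\<bar> \<partial>M)"
    using int by (intro real_cond_exp_int integrable_abs)
  finally show ?thesis .
qed

text \<open>
  By the contraction property the approximants, which conditioning leaves unchanged, converge both to \<open>s\<close> and to
  its conditional expectation. So an \<open>L\<^sup>1\<close>-limit of \<open>F\<close>-measurable functions has an \<open>F\<close>-measurable version.
\<close>

lemma (in prob_space) cond_exp_of_L1_limit:
  assumes F: "subalgebra M F" and s: "integrable M s"
    and u: "\<And>n. integrable M (u n)" "\<And>n. u n \<in> borel_measurable F"
    and lim: "(\<lambda>n. \<integral>x. \<bar>u n x - s x\<bar> \<partial>M) \<longlonglongrightarrow> 0"
  shows "AE x in M. real_cond_exp M F s x = s x"
proof (rule AE_symmetric, rule AE_eq_if_L1_limit_eq[OF s _ u(1) lim])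
  interpret finite_measure_subalgebra M F
    by unfold_locales (rule F)
  show "integrable M (real_cond_exp M F s)"
    using s by (rule real_cond_exp_int)
  show "(\<lambda>n. \<integral>x. \<bar>u n x - real_cond_exp M F s x\<bar> \<partial>M) \<longlonglongrightarrow> 0"
  proof (rule tendsto_sandwich[OF _ _ tendsto_const lim])
    have "(\<integral>x. \<bar>u n x - real_cond_exp M F s x\<bar> \<partial>M) \<le> (\<integral>x. \<bar>u n x - s x\<bar> \<partial>M)" for n
    proof -
      have "AE x in M. real_cond_exp M F (u n) x = u n x"
        using u by (rule real_cond_exp_F_meas)
      then have "(\<integral>x. \<bar>u n x - real_cond_exp M F s x\<bar> \<partial>M) = (\<integral>x. \<bar>real_cond_exp M F (u n) x - real_cond_exp M F s x\<bar> \<partial>M)"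
        using borel_measurable_integrable[OF u(1)] by (intro integral_cong_AE) auto
      then show ?thesis
        using cond_exp_L1_contraction[OF F u(1) s, of n] by simp
    qed
    then show "\<forall>\<^sub>F n in sequentially. (\<integral>x. \<bar>u n x - real_cond_exp M F s x\<bar> \<partial>M) \<le> (\<integral>x. \<bar>u n x - s x\<bar> \<partial>M)"
      by simp
  qed auto
qed

section \<open>Conditional expectation and a measure-preserving map\<close>

text \<open>
  The assumption \<open>past\<close> is \<open>F \<subseteq> T\<^sup>-\<^sup>1 F\<close>, that is \<open>F\<^sub>0 \<subseteq> F\<^sub>1\<close>.
\<close>

locale filtered_dynamics = prob_space M for M :: "'a measure" +
  fixes T :: "'a \<Rightarrow> 'a" and F :: "'a measure"
  assumes T_measurable [measurable]: "T \<in> M \<rightarrow>\<^sub>M M"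
    and distr_T: "distr M M T = M"
    and subalgebra_F: "subalgebra M F"
    and past: "\<And>A. A \<in> sets F \<Longrightarrow> \<exists>C\<in>sets F. A = T -` C \<inter> space M"
begin

sublocale finite_measure_subalgebra M F
  by unfold_locales (rule subalgebra_F)

abbreviation CE :: "('a \<Rightarrow> real) \<Rightarrow> 'a \<Rightarrow> real" where
  "CE \<equiv> real_cond_exp M F"

lemma F_measurable_imp_M: "f \<in> borel_measurable F \<Longrightarrow> f \<in> borel_measurable M"
  by (rule measurable_from_subalg[OF subalgebra_F])

lemma distr_iter: "distr M M (T ^^ n) = M"
proof (induction n)
  case (Suc n)
  have "distr M M (T ^^ Suc n) = distr (distr M M (T ^^ n)) M T"
    by (subst distr_distr) (auto simp: comp_def)
  then show ?case
    using Suc distr_T by (simp only:)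
qed (simp add: id_def distr_id)

lemma integrable_iter: "integrable M g \<Longrightarrow> integrable M (\<lambda>x. g ((T ^^ n) x))"
  for g :: "'a \<Rightarrow> real"
  using integrable_distr[of "T ^^ n" M M g] by (simp add: distr_iter)

lemma integral_iter: "g \<in> borel_measurable M \<Longrightarrow> (\<integral>x. g ((T ^^ n) x) \<partial>M) = (\<integral>x. g x \<partial>M)"
  for g :: "'a \<Rightarrow> real"
  using integral_distr[of "T ^^ n" M M g] by (simp add: distr_iter)

lemma AE_iter: "AE x in M. Q x \<Longrightarrow> AE x in M. Q ((T ^^ n) x)"
  using AE_distrD[of "T ^^ n" M M Q] unfolding distr_iter by simp

lemma in_L2_iter: "in_L2 M g \<Longrightarrow> in_L2 M (\<lambda>x. g ((T ^^ n) x))"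
  unfolding in_L2_def using integrable_iter[of "\<lambda>x. (g x)\<^sup>2"] by auto

lemmas integrable_T = integrable_iter[where n = 1, simplified]
  and integral_T = integral_iter[where n = 1, simplified]
  and AE_T = AE_iter[where n = 1, simplified]

lemma set_integral_T:
  fixes k :: "'a \<Rightarrow> real"
  assumes [measurable]: "C \<in> sets M" "k \<in> borel_measurable M"
  shows "(\<integral>x\<in>T -` C \<inter> space M. k (T x) \<partial>M) = (\<integral>x\<in>C. k x \<partial>M)"
proof -
  have "(\<integral>x\<in>T -` C \<inter> space M. k (T x) \<partial>M) = (\<integral>x. indicator C (T x) *\<^sub>R k (T x) \<partial>M)"
    unfolding set_lebesgue_integral_def by (intro Bochner_Integration.integral_cong) (auto simp: indicator_def)
  also have "\<dots> = (\<integral>x\<in>C. k x \<partial>M)"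
    unfolding set_lebesgue_integral_def by (rule integral_T) measurable
  finally show ?thesis .
qed

text \<open>
  Here \<open>F = T\<^sup>-\<^sup>1 G\<close>, so conditioning commutes with composition by \<open>T\<close>: integrals over a set of \<open>F\<close> become integrals
  over a set of \<open>G\<close> by invariance of the measure. With \<open>G = F\<^bsub>-1\<^esub>\<close> it moves the second term of \<open>P\<^sub>0\<close> back to \<open>F\<^sub>0\<close>.
\<close>

lemma cond_exp_pullback:
  assumes G: "subalgebra M G" and T: "T \<in> F \<rightarrow>\<^sub>M G"
    and FG: "\<And>A. A \<in> sets F \<Longrightarrow> \<exists>C\<in>sets G. A = T -` C \<inter> space M"
    and g: "integrable M g"
  shows "AE x in M. CE (\<lambda>y. g (T y)) x = real_cond_exp M G g (T x)"
proof (rule real_cond_exp_charact)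
  interpret G: finite_measure_subalgebra M G
    by unfold_locales (rule G)
  have [measurable]: "g \<in> borel_measurable M"
    using g by auto
  show "integrable M (\<lambda>y. g (T y))" "integrable M (\<lambda>x. real_cond_exp M G g (T x))"
    using g by (auto intro: integrable_T G.real_cond_exp_int)
  show "(\<lambda>x. real_cond_exp M G g (T x)) \<in> borel_measurable F"
    using T by (rule measurable_compose) simp
  fix A assume "A \<in> sets F"
  then obtain C where C: "C \<in> sets G" and A: "A = T -` C \<inter> space M"
    using FG by blast
  have [measurable]: "C \<in> sets M"
    using C G by (auto simp: subalgebra_def)
  show "(\<integral>x\<in>A. g (T x) \<partial>M) = (\<integral>x\<in>A. real_cond_exp M G g (T x) \<partial>M)"
    using G.real_cond_exp_intA[OF g C] by (simp add: A set_integral_T)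
qed

text \<open>
  A set of \<open>F\<close> is the preimage of some \<open>C\<close> in \<open>F\<close>, and integrals over \<open>C\<close> do not see the difference between
  \<open>g\<close> and its conditional expectation. Consequently \<open>g \<mapsto> \<E>(g \<circ> T | F)\<close> acts as an operator whose powers are
  \<open>g \<mapsto> \<E>(g \<circ> T\<^sup>n | F)\<close> (next lemma).
\<close>

lemma CE_T:
  assumes g: "integrable M g"
  shows "AE x in M. CE (\<lambda>y. CE g (T y)) x = CE (\<lambda>y. g (T y)) x"
proof (rule AE_symmetric, rule real_cond_exp_charact)
  have [measurable]: "g \<in> borel_measurable M"
    using g by auto
  show "integrable M (\<lambda>y. g (T y))" "integrable M (CE (\<lambda>y. CE g (T y)))"
    using g by (auto intro!: integrable_T real_cond_exp_int)
  show "CE (\<lambda>y. CE g (T y)) \<in> borel_measurable F"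
    by simp
  fix A assume A: "A \<in> sets F"
  then obtain C where C: "C \<in> sets F" and AC: "A = T -` C \<inter> space M"
    using past by blast
  have [measurable]: "C \<in> sets M"
    using C subalgebra_F by (auto simp: subalgebra_def)
  have "(\<integral>x\<in>A. g (T x) \<partial>M) = (\<integral>x\<in>A. CE g (T x) \<partial>M)"
    using real_cond_exp_intA[OF g C] by (simp add: AC set_integral_T)
  also have "\<dots> = (\<integral>x\<in>A. CE (\<lambda>y. CE g (T y)) x \<partial>M)"
    using g A by (intro real_cond_exp_intA integrable_T real_cond_exp_int)
  finally show "(\<integral>x\<in>A. g (T x) \<partial>M) = (\<integral>x\<in>A. CE (\<lambda>y. CE g (T y)) x \<partial>M)" .
qed

lemma CE_iter_Suc:
  assumes "integrable M g"
  shows "AE x in M. CE (\<lambda>y. CE (\<lambda>z. g ((T ^^ n) z)) (T y)) x = CE (\<lambda>y. g ((T ^^ Suc n) y)) x"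
  using CE_T[OF integrable_iter[OF assms, of n]] by (simp add: funpow_swap1)

section \<open>A maximal ergodic inequality\<close>

text \<open>
  For the operator \<open>Q g = \<E>(g \<circ> T | F)\<close>, the partial sums of \<open>Q\<^sup>i h - c\<close> over \<open>i = 1, \<dots>, k\<close> satisfy
  \<open>s\<^bsub>k+1\<^esub> = Q (h + s\<^sub>k) - c\<close>. Iterating the same map truncated at \<open>0\<close> gives a majorant of all of them that is
  simpler to handle than their maximum.
\<close>

primrec hopf :: "('a \<Rightarrow> real) \<Rightarrow> real \<Rightarrow> nat \<Rightarrow> 'a \<Rightarrow> real" where
  "hopf h c 0 = (\<lambda>x. 0)"
| "hopf h c (Suc n) = (\<lambda>x. max 0 (CE (\<lambda>y. h (T y) + hopf h c n (T y)) x - c))"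

lemma hopf_nonneg: "0 \<le> hopf h c n x"
  by (cases n) auto

lemma hopf_integrable:
  assumes "integrable M h"
  shows "integrable M (hopf h c n)"
proof (induction n)
  case (Suc n)
  then have "integrable M (CE (\<lambda>y. h (T y) + hopf h c n (T y)))"
    using assms by (intro real_cond_exp_int Bochner_Integration.integrable_add integrable_T)
  then show ?case
    using integrable_max[of M "\<lambda>x. 0" "\<lambda>x. CE (\<lambda>y. h (T y) + hopf h c n (T y)) x - c"] by simp
qed simp

lemma hopf_Suc_mono:
  assumes h: "integrable M h"
  shows "AE x in M. hopf h c n x \<le> hopf h c (Suc n) x"
proof (induction n)
  case (Suc n)
  have "AE x in M. CE (\<lambda>y. h (T y) + hopf h c n (T y)) x \<le> CE (\<lambda>y. h (T y) + hopf h c (Suc n) (T y)) x"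
  proof (rule real_cond_exp_mono)
    show "AE x in M. h (T x) + hopf h c n (T x) \<le> h (T x) + hopf h c (Suc n) (T x)"
      using AE_T[OF Suc] by auto
  qed (use h hopf_integrable[OF h] in \<open>simp_all only: integrable_T Bochner_Integration.integrable_add\<close>)
  then show ?case
    by eventually_elim auto
qed auto

lemma hopf_mono:
  assumes "integrable M h" "k \<le> n"
  shows "AE x in M. hopf h c k x \<le> hopf h c n x"
  using assms(2)
proof (induction n rule: dec_induct)
  case (step n)
  show ?case
    using step.IH hopf_Suc_mono[OF assms(1), of c n] by eventually_elim linarith
qed simp

text \<open>
  Let \<open>m\<^sub>k = hopf h c k\<close>. Where \<open>m\<^bsub>k+1\<^esub> > 0\<close> the truncation is inactive and \<open>c = Q h + Q m\<^sub>k - m\<^bsub>k+1\<^esub>\<close>; elsewhere the right-hand side is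
  nonnegative. Since \<open>Q\<close> preserves integrals and \<open>m\<^sub>k \<le> m\<^bsub>k+1\<^esub>\<close>, integrating leaves at most the integral
  of \<open>h\<close>. This is Garsia's argument for the Hopf maximal ergodic lemma.
\<close>

lemma hopf_maximal_inequality:
  assumes h: "integrable M h" and pos: "AE x in M. 0 \<le> h x"
  shows "c * measure M {x \<in> space M. 0 < hopf h c n x} \<le> (\<integral>x. h x \<partial>M)"
proof (cases n)
  case 0
  then show ?thesis
    using pos by (simp add: integral_nonneg_AE)
next
  case (Suc k)
  let ?g = "\<lambda>y. h (T y) + hopf h c k (T y)"
  let ?A = "{x \<in> space M. 0 < hopf h c n x}"
  have int: "integrable M ?g" "integrable M (CE ?g)" "integrable M (hopf h c i)" for i
    using h hopf_integrable[OF h] by (auto intro!: Bochner_Integration.integrable_add integrable_T real_cond_exp_int)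
  have [measurable]: "h \<in> borel_measurable M" "hopf h c i \<in> borel_measurable M" for i
    using h int by auto
  have "AE x in M. 0 \<le> CE ?g x"
    using AE_T[OF pos] by (intro real_cond_exp_pos) (auto simp: hopf_nonneg)
  then have ptw: "AE x in M. c * indicator ?A x \<le> CE ?g x - hopf h c n x"
    using AE_space by eventually_elim (auto simp: Suc indicator_def)
  have "c * measure M ?A = (\<integral>x. c * indicator ?A x \<partial>M)"
    by simp
  also have "\<dots> \<le> (\<integral>x. CE ?g x - hopf h c n x \<partial>M)"
    using ptw int by (intro integral_mono_AE Bochner_Integration.integrable_diff integrable_mult_right) (auto simp: less_top[symmetric])
  also have "\<dots> = (\<integral>x. CE ?g x \<partial>M) - (\<integral>x. hopf h c n x \<partial>M)"
    using int by (intro Bochner_Integration.integral_diff)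
  also have "(\<integral>x. CE ?g x \<partial>M) = (\<integral>x. ?g x \<partial>M)"
    using int by (intro real_cond_exp_int)
  also have "\<dots> = (\<integral>x. h (T x) \<partial>M) + (\<integral>x. hopf h c k (T x) \<partial>M)"
    using h int by (intro Bochner_Integration.integral_add integrable_T)
  also have "\<dots> = (\<integral>x. h x \<partial>M) + (\<integral>x. hopf h c k x \<partial>M)"
    by (simp add: integral_T)
  also have "(\<integral>x. hopf h c k x \<partial>M) \<le> (\<integral>x. hopf h c n x \<partial>M)"
    using int hopf_Suc_mono[OF h, of c k] by (intro integral_mono_AE) (simp_all only: Suc)
  finally show ?thesis
    by simp
qed

lemma partial_sum_le_hopf:
  assumes h: "integrable M h"
  shows "AE x in M. (\<Sum>i=1..k. CE (\<lambda>y. h ((T ^^ i) y)) x) - real k * c \<le> hopf h c k x"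
proof (induction k)
  case (Suc k)
  let ?q = "\<lambda>i. CE (\<lambda>y. h ((T ^^ i) y))"
  let ?s = "\<lambda>y. (\<Sum>i=1..k. ?q i y) - real k * c"
  have q: "integrable M (?q i)" for i
    using h by (intro real_cond_exp_int integrable_iter)
  have s: "integrable M ?s"
    using q by (intro Bochner_Integration.integrable_diff Bochner_Integration.integrable_sum) auto
  \<comment> \<open>The facts 2 to 7 compute \<open>\<E>((h + s\<^sub>k) \<circ> T | F) = s\<^bsub>k+1\<^esub> + c\<close>; fact 1 compares it with the truncated iteration.\<close>
  have 1: "AE x in M. CE (\<lambda>y. h (T y) + ?s (T y)) x \<le> CE (\<lambda>y. h (T y) + hopf h c k (T y)) x"
  proof (rule real_cond_exp_mono)
    show "AE x in M. h (T x) + ?s (T x) \<le> h (T x) + hopf h c k (T x)"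
      using AE_T[OF Suc] by eventually_elim simp
  qed (use h s hopf_integrable[OF h] in \<open>intro Bochner_Integration.integrable_add integrable_T; simp\<close>)+
  have 2: "AE x in M. CE (\<lambda>y. h (T y) + ?s (T y)) x = CE (\<lambda>y. h (T y)) x + CE (\<lambda>y. ?s (T y)) x"
    using integrable_T[OF h] integrable_T[OF s] by (rule real_cond_exp_add)
  have 3: "AE x in M. CE (\<lambda>y. ?s (T y)) x = CE (\<lambda>y. \<Sum>i=1..k. ?q i (T y)) x - CE (\<lambda>y. real k * c) x"
    using q by (intro real_cond_exp_diff Bochner_Integration.integrable_sum integrable_T[OF q]) auto
  have 4: "AE x in M. CE (\<lambda>y. \<Sum>i=1..k. ?q i (T y)) x = (\<Sum>i=1..k. CE (\<lambda>y. ?q i (T y)) x)"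
    by (intro real_cond_exp_sum integrable_T[OF q])
  have 5: "AE x in M. CE (\<lambda>y. real k * c) x = real k * c"
    by (rule real_cond_exp_F_meas) auto
  have 6: "AE x in M. \<forall>i. CE (\<lambda>y. ?q i (T y)) x = ?q (Suc i) x"
    unfolding AE_all_countable using CE_iter_Suc[OF h] by blast
  have 7: "(\<Sum>i=1..Suc k. ?q i x) = CE (\<lambda>y. h (T y)) x + (\<Sum>i=1..k. ?q (Suc i) x)" for x
  proof -
    have "(\<Sum>i=1..Suc k. ?q i x) = ?q 1 x + (\<Sum>i=Suc 1..Suc k. ?q i x)"
      by (rule sum.atLeast_Suc_atMost) simp
    then show ?thesis
      by (simp only: sum.shift_bounds_cl_Suc_ivl) simp
  qed
  show ?case
    using 1 2 3 4 5 6
  proof eventually_elim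
    case (elim x)
    have "(\<Sum>i=1..k. CE (\<lambda>y. ?q i (T y)) x) = (\<Sum>i=1..k. ?q (Suc i) x)"
      using elim(6) by (intro sum.cong) auto
    moreover have "CE (\<lambda>y. h (T y) + hopf h c k (T y)) x - c \<le> hopf h c (Suc k) x"
      by simp
    moreover have "real (Suc k) * c = real k * c + c"
      by (simp add: algebra_simps)
    ultimately show ?case
      using elim(1-5) 7[of x] by linarith
  qed
qed simp

text \<open>
  If one of the first \<open>n\<close> averages exceeds \<open>c\<close>, then \<open>hopf h c n\<close> is positive. The bound does not depend on \<open>n\<close>, so
  continuity of the measure along increasing events gives it for the supremum over all \<open>n\<close>.
\<close>

lemma maximal_ergodic_inequality:
  assumes h: "integrable M h" and pos: "AE x in M. 0 \<le> h x" and c: "0 < c"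
  shows "measure M {x \<in> space M. \<exists>k\<ge>1. real k * c < (\<Sum>i=1..k. CE (\<lambda>y. h ((T ^^ i) y)) x)}
           \<le> (\<integral>x. h x \<partial>M) / c"
proof -
  let ?s = "\<lambda>k x. \<Sum>i=1..k. CE (\<lambda>y. h ((T ^^ i) y)) x"
  define B where "B n = {x \<in> space M. \<exists>k\<in>{1..n}. real k * c < ?s k x}" for n :: nat
  have [measurable]: "B n \<in> sets M" for n
    unfolding B_def by measurable
  have [measurable]: "hopf h c n \<in> borel_measurable M" for n
    using hopf_integrable[OF h] by auto
  have le: "measure M (B n) \<le> (\<integral>x. h x \<partial>M) / c" for n
  proof -
    have "AE x in M. \<forall>k\<in>{1..n}. ?s k x - real k * c \<le> hopf h c k x \<and> hopf h c k x \<le> hopf h c n x"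
      using partial_sum_le_hopf[OF h] hopf_mono[OF h] by (intro AE_finite_allI AE_conjI) auto
    then have "AE x in M. x \<in> B n \<longrightarrow> x \<in> {x \<in> space M. 0 < hopf h c n x}"
      using AE_space by eventually_elim (fastforce simp: B_def)
    then have "measure M (B n) \<le> measure M {x \<in> space M. 0 < hopf h c n x}"
      by (rule finite_measure_mono_AE) measurable
    then show ?thesis
      using hopf_maximal_inequality[OF h pos, of c n] c
      by (smt (verit) mult.commute mult_left_mono pos_le_divide_eq)
  qed
  have "incseq B"
    unfolding B_def by (intro monoI) fastforce
  then have "(\<lambda>n. measure M (B n)) \<longlonglongrightarrow> measure M (\<Union>n. B n)"
    by (intro finite_Lim_measure_incseq) auto
  moreover have "(\<Union>n. B n) = {x \<in> space M. \<exists>k\<ge>1. real k * c < ?s k x}"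
    unfolding B_def by fastforce
  ultimately show ?thesis
    using le by (auto intro: LIMSEQ_le_const2)
qed

end

section \<open>Cesaro averages of conditional expectations\<close>

text \<open>
  Countably many levels \<open>c\<close> suffice, so the set where convergence fails is a countable union of null sets.
\<close>

lemma AE_LIMSEQ_zero:
  fixes V :: "nat \<Rightarrow> 'a \<Rightarrow> real"
  assumes "finite_measure M" and [measurable]: "\<And>n. V n \<in> borel_measurable M"
    and pos: "\<And>n. AE x in M. 0 \<le> V n x"
    and small: "\<And>c. 0 < c \<Longrightarrow> measure M {x \<in> space M. \<forall>m. \<exists>n\<ge>m. c < V n x} = 0"
  shows "AE x in M. (\<lambda>n. V n x) \<longlonglongrightarrow> 0"
proof -
  interpret finite_measure M by fact
  let ?B = "\<lambda>c. {x \<in> space M. \<forall>m. \<exists>n\<ge>m. c < V n x}"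
  have "AE x in M. x \<notin> ?B (1 / real (Suc j))" for j
    using small[of "1 / real (Suc j)"]
    by (intro AE_not_in) (auto simp: null_sets_def emeasure_eq_measure)
  then have "AE x in M. \<forall>j. x \<notin> ?B (1 / real (Suc j))"
    by (simp add: AE_all_countable)
  moreover have "AE x in M. \<forall>n. 0 \<le> V n x"
    using pos by (simp add: AE_all_countable)
  ultimately show ?thesis
    using AE_space
  proof eventually_elim
    case (elim x)
    show ?case
    proof (rule LIMSEQ_I)
      fix e :: real
      assume "0 < e"
      then obtain j where j: "1 / real (Suc j) < e"
        using nat_approx_posE by blast
      have "x \<notin> ?B (1 / real (Suc j))"
        using elim by blast
      then obtain m where "\<forall>n\<ge>m. V n x \<le> 1 / real (Suc j)"
        using elim(3) by (auto simp: not_less)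
      then have "\<forall>n\<ge>m. norm (V n x - 0) < e"
        using j elim(2) by (auto intro: le_less_trans)
      then show "\<exists>no. \<forall>n\<ge>no. norm (V n x - 0) < e" ..
    qed
  qed
qed

context filtered_dynamics
begin

lemma integral_excess_small:
  assumes W: "integrable M W" and "0 < e"
  shows "\<exists>A\<ge>0. (\<integral>x. max 0 (W x - A) \<partial>M) < (e :: real)"
proof -
  have [measurable]: "W \<in> borel_measurable M"
    using W by auto
  have "(\<lambda>n. \<integral>x. max 0 (W x - real n) \<partial>M) \<longlonglongrightarrow> (\<integral>x. 0 \<partial>M)"
  proof (rule integral_dominated_convergence[where w = "\<lambda>x. \<bar>W x\<bar>"])
    show "AE x in M. (\<lambda>n. max 0 (W x - real n)) \<longlonglongrightarrow> 0"
    proof (rule AE_I2, rule tendsto_eventually)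
      fix x
      obtain N where "W x \<le> real N"
        using real_arch_simple by blast
      then show "\<forall>\<^sub>F n in sequentially. max 0 (W x - real n) = 0"
        by (intro eventually_sequentiallyI[of N]) auto
    qed
  qed (use W in auto)
  then have "\<forall>\<^sub>F n in sequentially. (\<integral>x. max 0 (W x - real n) \<partial>M) < e"
    using \<open>0 < e\<close> by (intro order_tendstoD(2)) auto
  then show ?thesis
    by (auto simp: eventually_sequentially) (meson of_nat_0_le_iff order_refl)
qed

text \<open>
  Below a fixed index there are only finitely many functions, and their sum \<open>W\<close> splits into a part bounded by
  \<open>A\<close> and an excess of small integral, which is added to \<open>h\<close>.
\<close>

lemma uniform_domination:
  fixes r :: "nat \<Rightarrow> 'a \<Rightarrow> real"
  assumes r: "\<And>k. integrable M (r k)" and pos: "\<And>k x. 0 \<le> r k x"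
    and h: "integrable M h" "\<And>x. 0 \<le> h x" "\<And>k. N \<le> k \<Longrightarrow> AE x in M. r k x \<le> h x"
    and "0 < e"
  shows "\<exists>g A. integrable M g \<and> (\<forall>x. 0 \<le> g x) \<and> (\<integral>x. g x \<partial>M) \<le> (\<integral>x. h x \<partial>M) + e \<and> 0 \<le> A \<and>
           (\<forall>k. AE x in M. r k x \<le> g x + (if k < N then A else (0::real)))"
proof -
  define W where "W x = (\<Sum>k<N. r k x)" for x
  have W: "integrable M W"
    unfolding W_def using r by simp
  obtain A where A: "0 \<le> A" "(\<integral>x. max 0 (W x - A) \<partial>M) < e"
    using integral_excess_small[OF W \<open>0 < e\<close>] by blast
  let ?g = "\<lambda>x. h x + max 0 (W x - A)"
  have int: "integrable M (\<lambda>x. max 0 (W x - A))"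
    using W by (intro integrable_max) auto
  have "AE x in M. r k x \<le> ?g x + (if k < N then A else 0)" for k
  proof (cases "k < N")
    case True
    have "r k x \<le> W x" for x
      unfolding W_def using True pos by (intro member_le_sum) auto
    then show ?thesis
      using True h(2) by (intro AE_I2) (smt (verit))
  next
    case False
    then have "AE x in M. r k x \<le> h x"
      using h(3) by simp
    then show ?thesis
      by eventually_elim (use False in auto)
  qed
  moreover have "(\<integral>x. ?g x \<partial>M) \<le> (\<integral>x. h x \<partial>M) + e"
    using A(2) h(1) int by simp
  ultimately show ?thesis
    using A(1) h int by (intro exI[of _ ?g] exI[of _ A]) auto
qed

text \<open>
  In the average, \<open>r\<^sub>k\<close> appears with \<open>k = n + 1 - i\<close>, so only boundedly many terms have a small index. Up to these, the
  average is at most the ergodic average of a function of small integral, whose supremum over \<open>n\<close> is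
  controlled by the maximal inequality.
\<close>

lemma
  fixes r :: "nat \<Rightarrow> 'a \<Rightarrow> real"
  assumes r: "\<And>k. integrable M (r k)" and pos: "\<And>k x. 0 \<le> r k x"
    and dom: "\<And>e. 0 < e \<Longrightarrow> \<exists>N h. integrable M h \<and> (\<forall>x. 0 \<le> h x) \<and> (\<integral>x. h x \<partial>M) \<le> e \<and>
                (\<forall>k\<ge>N. AE x in M. r k x \<le> h x)"
  defines "V \<equiv> \<lambda>n x. 1 / real n * (\<Sum>i=1..n. CE (\<lambda>y. r (n + 1 - i) ((T ^^ i) y)) x)"
  shows cesaro_CE_AE: "AE x in M. (\<lambda>n. V n x) \<longlonglongrightarrow> 0"
    and cesaro_CE_L1: "(\<lambda>n. \<integral>x. V n x \<partial>M) \<longlonglongrightarrow> 0"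
proof -
  let ?q = "\<lambda>g i. CE (\<lambda>y. g ((T ^^ i) y))"
  have q_int: "integrable M (?q g i)" if "integrable M g" for g i
    using that by (intro real_cond_exp_int integrable_iter)
  have V_int: "integrable M (V n)" for n
    unfolding V_def using q_int r by (intro integrable_mult_right Bochner_Integration.integrable_sum) blast
  then have [measurable]: "V n \<in> borel_measurable M" for n
    by auto
  have [measurable]: "r k \<in> borel_measurable M" for k
    using r by auto
  have V_pos: "AE x in M. 0 \<le> V n x" for n
  proof -
    have "AE x in M. \<forall>i. 0 \<le> CE (\<lambda>y. r (n + 1 - i) ((T ^^ i) y)) x"
      unfolding AE_all_countable by (intro allI real_cond_exp_pos) (auto simp: pos)
    then show ?thesis
      by eventually_elim (auto simp: V_def intro!: divide_nonneg_nonneg sum_nonneg)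
  qed
  have bound: "\<exists>g C. integrable M g \<and> (\<forall>x. 0 \<le> g x) \<and> (\<integral>x. g x \<partial>M) \<le> e \<and>
      (AE x in M. \<forall>n. V n x \<le> 1 / real n * (\<Sum>i=1..n. ?q g i x) + C / real n)" if "0 < e" for e
  proof -
    obtain N h where h: "integrable M h" "\<And>x. 0 \<le> h x" "(\<integral>x. h x \<partial>M) \<le> e / 2"
        "\<And>k. N \<le> k \<Longrightarrow> AE x in M. r k x \<le> h x"
      using dom[of "e / 2"] \<open>0 < e\<close> by auto
    obtain g A where g: "integrable M g" "\<forall>x. 0 \<le> g x" "(\<integral>x. g x \<partial>M) \<le> (\<integral>x. h x \<partial>M) + e / 2" "0 \<le> A"
        and rg: "\<And>k. AE x in M. r k x \<le> g x + (if k < N then A else 0)"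
      using uniform_domination[where r = r and N = N and h = h and e = "e / 2", OF r pos h(1,2,4)] \<open>0 < e\<close>
      by auto
    let ?d = "\<lambda>k. if k < N then A else 0"
    have one: "AE x in M. CE (\<lambda>y. r k ((T ^^ i) y)) x \<le> ?q g i x + ?d k" for k i
    proof -
      have gi: "integrable M (\<lambda>y. g ((T ^^ i) y))"
        using g(1) by (rule integrable_iter)
      have "AE x in M. CE (\<lambda>y. r k ((T ^^ i) y)) x \<le> CE (\<lambda>y. g ((T ^^ i) y) + ?d k) x"
      proof (rule real_cond_exp_mono)
        show "AE x in M. r k ((T ^^ i) x) \<le> g ((T ^^ i) x) + ?d k"
          using rg by (rule AE_iter)
        show "integrable M (\<lambda>y. r k ((T ^^ i) y))" "integrable M (\<lambda>y. g ((T ^^ i) y) + ?d k)"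
          using integrable_iter[OF r] gi by simp_all
      qed
      moreover have "AE x in M. CE (\<lambda>y. g ((T ^^ i) y) + ?d k) x = ?q g i x + CE (\<lambda>y. ?d k) x"
        using gi by (rule real_cond_exp_add) simp
      moreover have "AE x in M. CE (\<lambda>y. ?d k) x = ?d k"
        by (rule real_cond_exp_F_meas) auto
      ultimately show ?thesis
        by eventually_elim linarith
    qed
    \<comment> \<open>The substitution \<open>k = n + 1 - i\<close> shows that at most \<open>N\<close> of the terms carry the constant \<open>A\<close>.\<close>
    have count: "(\<Sum>i=1..n. ?d (n + 1 - i)) \<le> real N * A" for n
    proof -
      have "(\<Sum>i=1..n. ?d (n + 1 - i)) = (\<Sum>k=1..n. ?d k)"
        by (subst sum.atLeastAtMost_rev) (simp add: add.commute)
      also have "\<dots> = (\<Sum>k\<in>{k \<in> {1..n}. k < N}. A)"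
        by (rule sum.inter_filter[symmetric]) simp
      also have "\<dots> \<le> (\<Sum>k<N. A)"
        using g(4) by (intro sum_mono2) auto
      finally show ?thesis
        by simp
    qed
    have "AE x in M. \<forall>n i. CE (\<lambda>y. r (n + 1 - i) ((T ^^ i) y)) x \<le> ?q g i x + ?d (n + 1 - i)"
      unfolding AE_all_countable by (intro allI one)
    then have "AE x in M. \<forall>n. V n x \<le> 1 / real n * (\<Sum>i=1..n. ?q g i x) + real N * A / real n"
    proof eventually_elim
      case (elim x)
      show ?case
      proof
        fix n
        have "(\<Sum>i=1..n. CE (\<lambda>y. r (n + 1 - i) ((T ^^ i) y)) x) \<le> (\<Sum>i=1..n. ?q g i x) + (\<Sum>i=1..n. ?d (n + 1 - i))"
          using elim unfolding sum.distrib[symmetric] by (intro sum_mono) blast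
        also have "\<dots> \<le> (\<Sum>i=1..n. ?q g i x) + real N * A"
          using count[of n] by linarith
        finally have "V n x \<le> 1 / real n * ((\<Sum>i=1..n. ?q g i x) + real N * A)"
          unfolding V_def by (intro mult_left_mono) auto
        then show "V n x \<le> 1 / real n * (\<Sum>i=1..n. ?q g i x) + real N * A / real n"
          by (simp add: distrib_left)
      qed
    qed
    moreover have "(\<integral>x. g x \<partial>M) \<le> e"
      using g(3) h(3) by linarith
    ultimately show ?thesis
      using g(1,2) by blast
  qed
  have to_0: "(\<lambda>n. C / real n) \<longlonglongrightarrow> 0" for C
    by (rule lim_const_over_n)
  show "AE x in M. (\<lambda>n. V n x) \<longlonglongrightarrow> 0"
  proof (rule AE_LIMSEQ_zero[OF finite_measure_axioms _ V_pos])
    fix c :: real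
    assume c: "0 < c"
    let ?B = "{x \<in> space M. \<forall>m. \<exists>n\<ge>m. c < V n x}"
    have "measure M ?B \<le> e" if "0 < e" for e
    proof -
      obtain g C where g: "integrable M g" "\<forall>x. 0 \<le> g x" "(\<integral>x. g x \<partial>M) \<le> e * (c / 2)"
          and Vg: "AE x in M. \<forall>n. V n x \<le> 1 / real n * (\<Sum>i=1..n. ?q g i x) + C / real n"
        using bound[of "e * (c / 2)"] c \<open>0 < e\<close> by auto
      let ?E = "{x \<in> space M. \<exists>k\<ge>1. real k * (c / 2) < (\<Sum>i=1..k. ?q g i x)}"
      have "\<forall>\<^sub>F n in sequentially. C / real n < c / 2"
        using c by (intro order_tendstoD(2)[OF to_0]) auto
      then obtain m where m: "\<And>n. m \<le> n \<Longrightarrow> C / real n < c / 2"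
        by (auto simp: eventually_sequentially)
      have "AE x in M. x \<in> ?B \<longrightarrow> x \<in> ?E"
        using Vg
      proof eventually_elim
        case (elim x)
        show ?case
        proof
          assume B: "x \<in> ?B"
          then have "\<exists>n\<ge>max 1 m. c < V n x"
            by blast
          then obtain n where n: "1 \<le> n" "m \<le> n" "c < V n x"
            by auto
          then have "c / 2 < 1 / real n * (\<Sum>i=1..n. ?q g i x)"
            using elim[rule_format, of n] m[of n] by linarith
          then have "real n * (c / 2) < (\<Sum>i=1..n. ?q g i x)"
            using n by (simp add: field_simps)
          then show "x \<in> ?E"
            using n B by auto
        qed
      qed
      then have "measure M ?B \<le> measure M ?E"
        by (rule finite_measure_mono_AE) measurable
      also have "\<dots> \<le> (\<integral>x. g x \<partial>M) / (c / 2)"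
        using g c by (intro maximal_ergodic_inequality) auto
      also have "\<dots> \<le> e"
        using g(3) c by (simp add: field_simps)
      finally show ?thesis .
    qed
    then have "measure M ?B \<le> 0"
      by (rule field_le_epsilon[where y = 0, simplified])
    then show "measure M ?B = 0"
      using measure_nonneg[of M ?B] by linarith
  qed measurable
  show "(\<lambda>n. \<integral>x. V n x \<partial>M) \<longlonglongrightarrow> 0"
  proof (rule LIMSEQ_I)
    fix e :: real
    assume "0 < e"
    then obtain g C where g: "integrable M g" "(\<integral>x. g x \<partial>M) \<le> e / 2"
        and Vg: "AE x in M. \<forall>n. V n x \<le> 1 / real n * (\<Sum>i=1..n. ?q g i x) + C / real n"
      using bound[of "e / 2"] by auto
    obtain m where m: "\<And>n. m \<le> n \<Longrightarrow> C / real n < e / 2"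
      using order_tendstoD(2)[OF to_0, of "e / 2" C] \<open>0 < e\<close> by (auto simp: eventually_sequentially)
    have "norm ((\<integral>x. V n x \<partial>M) - 0) < e" if n: "max 1 m \<le> n" for n
    proof -
      have "(\<integral>x. V n x \<partial>M) \<le> (\<integral>x. 1 / real n * (\<Sum>i=1..n. ?q g i x) + C / real n \<partial>M)"
        using Vg q_int[OF g(1)] V_int by (intro integral_mono_AE) auto
      also have "\<dots> = 1 / real n * (\<integral>x. (\<Sum>i=1..n. ?q g i x) \<partial>M) + C / real n"
        using q_int[OF g(1)] by (simp add: prob_space)
      also have "(\<integral>x. (\<Sum>i=1..n. ?q g i x) \<partial>M) = (\<Sum>i=1..n. \<integral>x. ?q g i x \<partial>M)"
        using q_int[OF g(1)] by (intro Bochner_Integration.integral_sum)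
      also have "\<dots> = real n * (\<integral>x. g x \<partial>M)"
        using real_cond_exp_int(2)[OF integrable_iter[OF g(1)]] g(1) by (simp add: integral_iter)
      finally have "(\<integral>x. V n x \<partial>M) \<le> (\<integral>x. g x \<partial>M) + C / real n"
        using n by simp
      then have "(\<integral>x. V n x \<partial>M) < e"
        using n m[of n] g(2) by linarith
      then show ?thesis
        using integral_nonneg_AE[OF V_pos] by simp
    qed
    then show "\<exists>no. \<forall>n\<ge>no. norm ((\<integral>x. V n x \<partial>M) - 0) < e"
      by blast
  qed
qed

end

section \<open>Stationary martingale differences\<close>

context filtered_dynamics
begin

lemma CE_iter_zero:
  assumes r: "integrable M r" and mds: "AE x in M. CE (\<lambda>y. r (T y)) x = 0"
  shows "AE x in M. CE (\<lambda>y. r ((T ^^ Suc i) y)) x = 0"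
proof (induction i)
  case 0
  then show ?case
    using mds by simp
next
  case (Suc i)
  have "AE x in M. CE (\<lambda>y. CE (\<lambda>z. r ((T ^^ Suc i) z)) (T y)) x = CE (\<lambda>y. 0) x"
    using AE_T[OF Suc] by (intro real_cond_exp_cong) auto
  moreover have "AE x in M. CE (\<lambda>y. 0) x = 0"
    by (rule real_cond_exp_F_meas) auto
  ultimately show ?case
    using CE_iter_Suc[OF r, of "Suc i"] by eventually_elim simp
qed

lemma CE_martingale_zero:
  assumes r: "\<And>i. integrable M (r i)" and mds: "\<And>i. AE x in M. CE (\<lambda>y. r i (T y)) x = 0"
  shows "AE x in M. CE (\<lambda>y. \<Sum>i=1..n. r i ((T ^^ i) y)) x = 0"
proof -
  have "AE x in M. CE (\<lambda>y. \<Sum>i=1..n. r i ((T ^^ i) y)) x = (\<Sum>i=1..n. CE (\<lambda>y. r i ((T ^^ i) y)) x)"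
    using r by (intro real_cond_exp_sum integrable_iter)
  moreover have "AE x in M. \<forall>j. CE (\<lambda>y. r (Suc j) ((T ^^ Suc j) y)) x = 0"
    unfolding AE_all_countable using CE_iter_zero[OF r mds] by blast
  ultimately show ?thesis
  proof eventually_elim
    case (elim x)
    have "CE (\<lambda>y. r i ((T ^^ i) y)) x = 0" if "i \<in> {1..n}" for i
      using elim(2)[rule_format, of "i - 1"] that by (cases i) auto
    then show ?case
      using elim(1) by simp
  qed
qed

text \<open>
  By induction on \<open>n\<close>, peeling off the first increment: the sum is \<open>(r\<^sub>1 + W) \<circ> T\<close> with \<open>W\<close> a sum of the same
  kind of length \<open>n - 1\<close>. Given \<open>F\<close>, the mixed term \<open>r\<^sub>1 W\<close> has conditional expectation \<open>r\<^sub>1 \<E>(W | F) = 0\<close>, and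
  the outer composition with \<open>T\<close> is absorbed by \<open>CE_T\<close>. The functions depend on \<open>i\<close>
  because the application takes \<open>r\<^sub>i = R\<^bsub>n+1-i\<^esub>\<close>.
\<close>

lemma CE_martingale_square:
  assumes L2: "\<And>i. in_L2 M (r i)" and F: "\<And>i. r i \<in> borel_measurable F"
    and mds: "\<And>i. AE x in M. CE (\<lambda>y. r i (T y)) x = 0"
  shows "AE x in M. CE (\<lambda>y. (\<Sum>i=1..n. r i ((T ^^ i) y))\<^sup>2) x = (\<Sum>i=1..n. CE (\<lambda>y. (r i ((T ^^ i) y))\<^sup>2) x)"
  using assms
proof (induction n arbitrary: r)
  case 0
  have "AE x in M. CE (\<lambda>y. 0) x = 0"
    by (rule real_cond_exp_F_meas) auto
  then show ?case
    by simp
next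
  case (Suc n)
  note L2 = Suc.prems(1) and F = Suc.prems(2) and mds = Suc.prems(3)
  have L2': "in_L2 M (\<lambda>y. r i ((T ^^ j) y))" for i j
    using L2 by (rule in_L2_iter)
  have sq_int: "integrable M (\<lambda>y. (r i y)\<^sup>2)" for i
    using L2 by (simp add: in_L2_def)
  define W where "W y = (\<Sum>i=1..n. r (Suc i) ((T ^^ i) y))" for y
  have W: "in_L2 M W"
    unfolding W_def using L2' by (rule in_L2_sum)
  have W_sq: "integrable M (\<lambda>y. (W y)\<^sup>2)" and [measurable]: "W \<in> borel_measurable M"
    using W by (auto simp: in_L2_def)
  have rW: "integrable M (\<lambda>y. r 1 y * W y)"
    using L2 W by (rule in_L2_mult_integrable)
  have split: "(\<Sum>i=1..Suc n. g i ((T ^^ i) y)) = g 1 (T y) + (\<Sum>i=1..n. g (Suc i) ((T ^^ i) (T y)))"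
    for g :: "nat \<Rightarrow> 'a \<Rightarrow> real" and y
  proof -
    have "(\<Sum>i=1..Suc n. g i ((T ^^ i) y)) = g 1 ((T ^^ 1) y) + (\<Sum>i=Suc 1..Suc n. g i ((T ^^ i) y))"
      by (rule sum.atLeast_Suc_atMost) simp
    then show ?thesis
      by (simp only: sum.shift_bounds_cl_Suc_ivl funpow_Suc_right comp_apply) simp
  qed
  have one: "AE x in M. CE (\<lambda>y. (r 1 y + W y)\<^sup>2) x = (r 1 x)\<^sup>2 + (\<Sum>i=1..n. CE (\<lambda>y. (r (Suc i) ((T ^^ i) y))\<^sup>2) x)"
  proof -
    have "(\<lambda>y. (r 1 y + W y)\<^sup>2) = (\<lambda>y. ((r 1 y)\<^sup>2 + 2 * (r 1 y * W y)) + (W y)\<^sup>2)"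
      by (auto simp: power2_eq_square algebra_simps)
    then have "AE x in M. CE (\<lambda>y. (r 1 y + W y)\<^sup>2) x = CE (\<lambda>y. (r 1 y)\<^sup>2 + 2 * (r 1 y * W y)) x + CE (\<lambda>y. (W y)\<^sup>2) x"
      using real_cond_exp_add[OF Bochner_Integration.integrable_add[OF sq_int[of 1] integrable_mult_right[of 2, OF rW]] W_sq]
      by simp
    moreover have "AE x in M. CE (\<lambda>y. (r 1 y)\<^sup>2 + 2 * (r 1 y * W y)) x = CE (\<lambda>y. (r 1 y)\<^sup>2) x + CE (\<lambda>y. 2 * (r 1 y * W y)) x"
      using sq_int rW by (intro real_cond_exp_add) auto
    moreover have "AE x in M. CE (\<lambda>y. 2 * (r 1 y * W y)) x = 2 * CE (\<lambda>y. r 1 y * W y) x"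
      using rW by (rule real_cond_exp_cmult)
    moreover have "AE x in M. CE (\<lambda>y. r 1 y * W y) x = r 1 x * CE W x"
      using F rW by (intro real_cond_exp_mult) auto
    moreover have "AE x in M. CE W x = 0"
      unfolding W_def using L2 mds by (intro CE_martingale_zero in_L2_integrable)
    moreover have "AE x in M. CE (\<lambda>y. (r 1 y)\<^sup>2) x = (r 1 x)\<^sup>2"
      using F sq_int by (intro real_cond_exp_F_meas) auto
    moreover have "AE x in M. CE (\<lambda>y. (W y)\<^sup>2) x = (\<Sum>i=1..n. CE (\<lambda>y. (r (Suc i) ((T ^^ i) y))\<^sup>2) x)"
      unfolding W_def using L2 F mds by (rule Suc.IH)
    ultimately show ?thesis
      by eventually_elim simp
  qed
  let ?h = "\<lambda>i. CE (\<lambda>y. (r (Suc i) ((T ^^ i) y))\<^sup>2)"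
  have h: "integrable M (?h i)" for i
    by (intro real_cond_exp_int integrable_iter[of "\<lambda>y. (r (Suc i) y)\<^sup>2"] sq_int)
  have rW_sq: "integrable M (\<lambda>y. (r 1 y + W y)\<^sup>2)"
    using in_L2_add[OF L2[of 1] W] by (simp add: in_L2_def)
  have "(\<lambda>y. (\<Sum>i=1..Suc n. r i ((T ^^ i) y))\<^sup>2) = (\<lambda>y. (r 1 (T y) + W (T y))\<^sup>2)"
    unfolding split[of r] W_def ..
  then have 1: "AE x in M. CE (\<lambda>y. (\<Sum>i=1..Suc n. r i ((T ^^ i) y))\<^sup>2) x = CE (\<lambda>y. CE (\<lambda>y. (r 1 y + W y)\<^sup>2) (T y)) x"
    using AE_symmetric[OF CE_T[OF rW_sq]] by simp
  have 2: "AE x in M. CE (\<lambda>y. CE (\<lambda>y. (r 1 y + W y)\<^sup>2) (T y)) x = CE (\<lambda>y. (r 1 (T y))\<^sup>2 + (\<Sum>i=1..n. ?h i (T y))) x"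
    using AE_T[OF one] F_measurable_imp_M[OF F] by (intro real_cond_exp_cong) auto
  have 3: "AE x in M. CE (\<lambda>y. (r 1 (T y))\<^sup>2 + (\<Sum>i=1..n. ?h i (T y))) x
             = CE (\<lambda>y. (r 1 (T y))\<^sup>2) x + CE (\<lambda>y. \<Sum>i=1..n. ?h i (T y)) x"
    by (intro real_cond_exp_add Bochner_Integration.integrable_sum integrable_T[OF h] integrable_T[OF sq_int])
  have 4: "AE x in M. CE (\<lambda>y. \<Sum>i=1..n. ?h i (T y)) x = (\<Sum>i=1..n. CE (\<lambda>y. ?h i (T y)) x)"
    by (intro real_cond_exp_sum integrable_T[OF h])
  have 5: "AE x in M. \<forall>i. CE (\<lambda>y. ?h i (T y)) x = CE (\<lambda>y. (r (Suc i) ((T ^^ Suc i) y))\<^sup>2) x"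
    unfolding AE_all_countable using CE_iter_Suc[OF sq_int] by blast
  have 6: "(\<Sum>i=1..Suc n. CE (\<lambda>y. (r i ((T ^^ i) y))\<^sup>2) x)
      = CE (\<lambda>y. (r 1 (T y))\<^sup>2) x + (\<Sum>i=1..n. CE (\<lambda>y. (r (Suc i) ((T ^^ Suc i) y))\<^sup>2) x)" for x
  proof -
    have "(\<Sum>i=1..Suc n. CE (\<lambda>y. (r i ((T ^^ i) y))\<^sup>2) x)
      = CE (\<lambda>y. (r 1 ((T ^^ 1) y))\<^sup>2) x + (\<Sum>i=Suc 1..Suc n. CE (\<lambda>y. (r i ((T ^^ i) y))\<^sup>2) x)"
      by (rule sum.atLeast_Suc_atMost) simp
    then show ?thesis
      by (simp only: sum.shift_bounds_cl_Suc_ivl) simp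
  qed
  show ?case
    using 1 2 3 4 5
  proof eventually_elim
    case (elim x)
    have "(\<Sum>i=1..n. CE (\<lambda>y. ?h i (T y)) x) = (\<Sum>i=1..n. CE (\<lambda>y. (r (Suc i) ((T ^^ Suc i) y))\<^sup>2) x)"
      using elim(5) by (intro sum.cong) auto
    then show ?case
      using elim(1-4) 6[of x] by linarith
  qed
qed

end

section \<open>The approximation error\<close>

text \<open>
  Both parts use the Cauchy-Schwarz inequality: for the bound on the whole block \<open>1, \<dots>, n\<close>, for the limit only on
  a block beyond \<open>N\<close>, where the tail of the series is small. The first \<open>N\<close> terms are negligible against \<open>n\<close>.
\<close>

lemma
  fixes a :: "nat \<Rightarrow> real"
  assumes a: "summable (\<lambda>k. (a k)\<^sup>2)"
  shows square_sum_le_suminf: "1 / real n * (\<Sum>m=1..n. a m)\<^sup>2 \<le> (\<Sum>k. (a k)\<^sup>2)"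
    and square_sum_tendsto_0: "(\<lambda>n. 1 / real n * (\<Sum>m=1..n. a m)\<^sup>2) \<longlonglongrightarrow> 0"
proof -
  have block: "(\<Sum>m\<in>I. a m)\<^sup>2 \<le> real (card I) * (\<Sum>m\<in>I. (a m)\<^sup>2)" for I
    using sum_squared_le_sum_of_squares[of a I] by (simp add: mult.commute)
  show "1 / real n * (\<Sum>m=1..n. a m)\<^sup>2 \<le> (\<Sum>k. (a k)\<^sup>2)"
  proof (cases "n = 0")
    case False
    have "1 / real n * (\<Sum>m=1..n. a m)\<^sup>2 \<le> (\<Sum>m=1..n. (a m)\<^sup>2)"
      using block[of "{1..n}"] False by (simp add: field_simps)
    also have "\<dots> \<le> (\<Sum>k. (a k)\<^sup>2)"
      using a by (intro sum_le_suminf) auto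
    finally show ?thesis .
  qed (use a in \<open>simp add: suminf_nonneg\<close>)
  show "(\<lambda>n. 1 / real n * (\<Sum>m=1..n. a m)\<^sup>2) \<longlonglongrightarrow> 0"
  proof (rule LIMSEQ_I)
    fix e :: real
    assume "0 < e"
    then obtain N where N: "\<And>m n. N \<le> m \<Longrightarrow> norm (\<Sum>k=m..<n. (a k)\<^sup>2) < e / 4"
      using a[unfolded summable_Cauchy, rule_format, of "e / 4"] by auto
    define C where "C = (\<Sum>m=1..N. a m)\<^sup>2"
    have "(\<lambda>n. 2 * C / real n) \<longlonglongrightarrow> 0"
      by (rule lim_const_over_n)
    then have "\<forall>\<^sub>F n in sequentially. 2 * C / real n < e / 2"
      using \<open>0 < e\<close> by (intro order_tendstoD(2)) auto
    then obtain m where m: "\<And>n. m \<le> n \<Longrightarrow> 2 * C / real n < e / 2"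
      by (auto simp: eventually_sequentially)
    have "norm (1 / real n * (\<Sum>m=1..n. a m)\<^sup>2 - 0) < e" if n: "max (Suc N) m \<le> n" for n
    proof -
      let ?t = "\<Sum>k=Suc N..n. a k"
      have "?t\<^sup>2 \<le> real (card {Suc N..n}) * (\<Sum>k=Suc N..n. (a k)\<^sup>2)"
        by (rule block)
      also have "\<dots> \<le> real n * (e / 4)"
        using N[of "Suc N" "Suc n"]
        by (intro mult_mono) (auto simp: atLeastLessThanSuc_atLeastAtMost sum_nonneg)
      finally have t: "?t\<^sup>2 \<le> real n * (e / 4)" .
      have "(\<Sum>m=1..n. a m) = (\<Sum>m=1..N. a m) + ?t"
        using n sum.ub_add_nat[of 1 N a "n - N"] by simp
      then have "(\<Sum>m=1..n. a m)\<^sup>2 = ((\<Sum>m=1..N. a m) + ?t)\<^sup>2"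
        by simp
      also have "\<dots> \<le> 2 * C + 2 * ?t\<^sup>2"
        unfolding C_def using power2_diff_le[of "\<Sum>m=1..N. a m" "- ?t"] by simp
      finally have "1 / real n * (\<Sum>m=1..n. a m)\<^sup>2 \<le> 1 / real n * (2 * C + real n * (e / 2))"
        using t by (intro mult_left_mono) auto
      also have "\<dots> = 2 * C / real n + e / 2"
        using n by (simp add: field_simps)
      also have "\<dots> < e"
        using m[of n] n by simp
      finally show ?thesis
        by simp
    qed
    then show "\<exists>no. \<forall>n\<ge>no. norm (1 / real n * (\<Sum>m=1..n. a m)\<^sup>2 - 0) < e"
      by blast
  qed
qed

text \<open>
  The integrable function \<open>\<Sum>k. a\<^sub>k\<^sup>2\<close> dominates all the averages.
\<close>

lemma square_sum_Cesaro_AE_L1: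
  fixes a :: "nat \<Rightarrow> 'a \<Rightarrow> real"
  assumes a: "\<And>k. in_L2 M (a k)" and sum: "summable (\<lambda>k. (L2_norm M (a k))\<^sup>2)"
  defines "U \<equiv> \<lambda>n x. 1 / real n * (\<Sum>m=1..n. a m x)\<^sup>2"
  shows "AE x in M. (\<lambda>n. U n x) \<longlonglongrightarrow> 0"
    and "(\<lambda>n. \<integral>x. U n x \<partial>M) \<longlonglongrightarrow> 0"
proof -
  have [measurable]: "a k \<in> borel_measurable M" and int: "integrable M (\<lambda>x. (a k x)\<^sup>2)" for k
    using a by (auto simp: in_L2_def)
  have norm: "(L2_norm M (a k))\<^sup>2 = (\<integral>x. (a k x)\<^sup>2 \<partial>M)" for k
    by (simp add: L2_norm_def)
  have "(\<integral>\<^sup>+x. (\<Sum>k. ennreal ((a k x)\<^sup>2)) \<partial>M) = (\<Sum>k. \<integral>\<^sup>+x. ennreal ((a k x)\<^sup>2) \<partial>M)"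
    by (rule nn_integral_suminf) measurable
  also have "\<dots> = (\<Sum>k. ennreal ((L2_norm M (a k))\<^sup>2))"
    using int by (intro suminf_cong) (simp add: norm nn_integral_eq_integral)
  also have "\<dots> = ennreal (\<Sum>k. (L2_norm M (a k))\<^sup>2)"
    using sum by (intro suminf_ennreal2) auto
  finally have "(\<integral>\<^sup>+x. (\<Sum>k. ennreal ((a k x)\<^sup>2)) \<partial>M) \<noteq> \<infinity>"
    by simp
  then have "AE x in M. (\<Sum>k. ennreal ((a k x)\<^sup>2)) \<noteq> \<infinity>"
    by (intro nn_integral_PInf_AE) measurable
  then have ae: "AE x in M. summable (\<lambda>k. (a k x)\<^sup>2)"
    by eventually_elim (auto intro: summable_suminf_not_top)
  show lim: "AE x in M. (\<lambda>n. U n x) \<longlonglongrightarrow> 0"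
    using ae unfolding U_def by eventually_elim (rule square_sum_tendsto_0)
  have w: "integrable M (\<lambda>x. \<Sum>k. (a k x)\<^sup>2)"
    using int ae sum by (intro integrable_suminf) (auto simp: norm)
  have "(\<lambda>n. \<integral>x. U n x \<partial>M) \<longlonglongrightarrow> (\<integral>x. 0 \<partial>M)"
  proof (rule integral_dominated_convergence[where w = "\<lambda>x. \<Sum>k. (a k x)\<^sup>2"])
    show "AE x in M. norm (U n x) \<le> (\<Sum>k. (a k x)\<^sup>2)" for n
      using ae unfolding U_def
      by eventually_elim (simp only: real_norm_def abs_of_nonneg zero_le_power2 zero_le_mult_iff zero_le_divide_1_iff of_nat_0_le_iff square_sum_le_suminf simp_thms)
    show "U n \<in> borel_measurable M" for n
      unfolding U_def by measurable
  qed (use lim w in auto)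
  then show "(\<lambda>n. \<integral>x. U n x \<partial>M) \<longlonglongrightarrow> 0"
    by simp
qed

text \<open>
  Here \<open>\<alpha> k i\<close> stands for \<open>a\<^sub>k \<circ> T\<^sup>i\<close> and \<open>\<pi> k i\<close> for \<open>p\<^sub>k \<circ> T\<^sup>i\<close>. On each diagonal \<open>k + i = m\<close> of the triangle the
  hypothesis is a telescoping difference, with total \<open>\<alpha> 0 m - \<alpha> m 0\<close>.
\<close>

lemma triangular_telescoping:
  fixes \<alpha> \<pi> :: "nat \<Rightarrow> nat \<Rightarrow> real"
  assumes \<pi>: "\<And>k i. \<pi> k (Suc i) = \<alpha> k (Suc i) - \<alpha> (Suc k) i"
  shows "(\<Sum>m=1..n. \<alpha> 0 m) = (\<Sum>m=1..n. \<alpha> m 0) + (\<Sum>i=1..n. \<Sum>j<n + 1 - i. \<pi> j i)"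
proof (induction n)
  case (Suc n)
  define b where "b i = \<alpha> (Suc n - i) i" for i
  have "(\<Sum>i=1..Suc n. \<pi> (Suc n - i) i) = (\<Sum>i=Suc 0..Suc n. b i - b (i - 1))"
  proof (rule sum.cong)
    fix i
    assume "i \<in> {Suc 0..Suc n}"
    then obtain l where l: "i = Suc l" "l \<le> n"
      by (cases i) auto
    then show "\<pi> (Suc n - i) i = b i - b (i - 1)"
      using \<pi>[of "n - l" l] by (simp add: b_def Suc_diff_le)
  qed simp
  also have "\<dots> = b (Suc n) - b 0"
    by (rule sum_telescope'') simp
  finally have diagonal: "(\<Sum>i=1..Suc n. \<pi> (Suc n - i) i) = \<alpha> 0 (Suc n) - \<alpha> (Suc n) 0"
    by (simp add: b_def)
  have "(\<Sum>i=1..Suc n. \<Sum>j<Suc n + 1 - i. \<pi> j i) = (\<Sum>i=1..Suc n. (\<Sum>j<n + 1 - i. \<pi> j i) + \<pi> (Suc n - i) i)"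
    by (intro sum.cong) (auto simp: Suc_diff_le)
  also have "\<dots> = (\<Sum>i=1..n. \<Sum>j<n + 1 - i. \<pi> j i) + (\<Sum>i=1..Suc n. \<pi> (Suc n - i) i)"
    by (simp add: sum.distrib)
  finally show ?case
    using Suc diagonal by simp
qed simp

context filtered_dynamics
begin

lemma in_L2_CE:
  assumes "in_L2 M f"
  shows "in_L2 M (CE f)"
proof -
  have "integrable M (\<lambda>x. (CE f x)\<^sup>2)"
    using assms in_L2_integrable[OF assms] convex_power2
    by (intro integrable_convex_cond_exp[where I = UNIV and q = "\<lambda>x. x\<^sup>2"]) (auto simp: in_L2_def)
  then show ?thesis
    by (simp add: in_L2_def)
qed

text \<open>
  Conditioning \<open>a\<^sub>k \<circ> T\<close> on \<open>F\<close> gives \<open>a\<^bsub>k+1\<^esub>\<close>, which cancels the subtracted term.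
\<close>

lemma increments_CE_zero:
  assumes X: "integrable M X"
    and p: "p \<in> borel_measurable M"
    and "AE x in M. p (T x) = CE (\<lambda>y. X ((T ^^ k) y)) (T x) - CE (\<lambda>y. X ((T ^^ Suc k) y)) x"
  shows "AE x in M. CE (\<lambda>y. p (T y)) x = 0"
proof -
  let ?a = "\<lambda>k. CE (\<lambda>y. X ((T ^^ k) y))"
  have a: "integrable M (?a k)" for k
    using integrable_iter[OF X] by (rule real_cond_exp_int)
  have "AE x in M. CE (\<lambda>y. p (T y)) x = CE (\<lambda>y. ?a k (T y) - ?a (Suc k) y) x"
    using assms by (intro real_cond_exp_cong) auto
  moreover have "AE x in M. CE (\<lambda>y. ?a k (T y) - ?a (Suc k) y) x = CE (\<lambda>y. ?a k (T y)) x - CE (?a (Suc k)) x"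
    using integrable_T[OF a[of k]] a[of "Suc k"] by (rule real_cond_exp_diff)
  moreover have "AE x in M. CE (\<lambda>y. ?a k (T y)) x = ?a (Suc k) x"
    using CE_iter_Suc[OF X] .
  moreover have "AE x in M. CE (?a (Suc k)) x = ?a (Suc k) x"
    using a[of "Suc k"] by (intro real_cond_exp_F_meas) auto
  ultimately show ?thesis
    by eventually_elim linarith
qed

text \<open>
  Composition with \<open>T\<close> and conditional expectation do not increase \<open>L\<^sup>1\<close>-norms, so the identity passes from the
  partial sums to the limit.
\<close>

lemma L2_sum_CE_zero:
  assumes p: "L2_sums M p D" and mds: "\<And>k. AE x in M. CE (\<lambda>y. p k (T y)) x = 0"
  shows "AE x in M. CE (\<lambda>y. D (T y)) x = 0"
proof (rule AE_eq_if_L1_limit_eq)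
  let ?u = "\<lambda>n x. \<Sum>i<n. p i x"
  have p_int: "integrable M (p i)" and D: "integrable M D" for i
    using p by (auto simp: L2_sums_def in_L2_integrable)
  have u: "integrable M (?u n)" for n
    using p_int by simp
  show u_int: "integrable M (CE (\<lambda>y. ?u n (T y)))" for n
    using integrable_T[OF u] by (rule real_cond_exp_int)
  show "integrable M (CE (\<lambda>y. D (T y)))" "integrable M (\<lambda>x. 0 :: real)"
    using integrable_T[OF D] by (auto intro: real_cond_exp_int)
  have "AE x in M. CE (\<lambda>y. ?u n (T y)) x = 0" for n
  proof -
    have "AE x in M. CE (\<lambda>y. ?u n (T y)) x = (\<Sum>i<n. CE (\<lambda>y. p i (T y)) x)"
      using integrable_T[OF p_int] by (rule real_cond_exp_sum)
    moreover have "AE x in M. \<forall>i. CE (\<lambda>y. p i (T y)) x = 0"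
      using mds by (simp add: AE_all_countable)
    ultimately show ?thesis
      by eventually_elim simp
  qed
  then have "(\<integral>x. \<bar>CE (\<lambda>y. ?u n (T y)) x - 0\<bar> \<partial>M) = (\<integral>x. 0 \<partial>M)" for n
    by (intro integral_cong_AE) auto
  then show "(\<lambda>n. \<integral>x. \<bar>CE (\<lambda>y. ?u n (T y)) x - 0\<bar> \<partial>M) \<longlonglongrightarrow> 0"
    by simp
  show "(\<lambda>n. \<integral>x. \<bar>CE (\<lambda>y. ?u n (T y)) x - CE (\<lambda>y. D (T y)) x\<bar> \<partial>M) \<longlonglongrightarrow> 0"
  proof (rule tendsto_sandwich[OF _ _ tendsto_const L2_sums_imp_L1[OF p]])
    have "(\<integral>x. \<bar>CE (\<lambda>y. ?u n (T y)) x - CE (\<lambda>y. D (T y)) x\<bar> \<partial>M) \<le> (\<integral>x. \<bar>?u n x - D x\<bar> \<partial>M)" for n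
    proof -
      have "(\<integral>x. \<bar>CE (\<lambda>y. ?u n (T y)) x - CE (\<lambda>y. D (T y)) x\<bar> \<partial>M) \<le> (\<integral>x. \<bar>?u n (T x) - D (T x)\<bar> \<partial>M)"
        using subalgebra_F integrable_T[OF u] integrable_T[OF D] by (rule cond_exp_L1_contraction)
      also have "\<dots> = (\<integral>x. \<bar>?u n x - D x\<bar> \<partial>M)"
        using borel_measurable_integrable[OF p_int] borel_measurable_integrable[OF D]
        by (intro integral_T[of "\<lambda>x. \<bar>?u n x - D x\<bar>"]) measurable
      finally show ?thesis .
    qed
    then show "\<forall>\<^sub>F n in sequentially. (\<integral>x. \<bar>CE (\<lambda>y. ?u n (T y)) x - CE (\<lambda>y. D (T y)) x\<bar> \<partial>M) \<le> (\<integral>x. \<bar>?u n x - D x\<bar> \<partial>M)"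
      by simp
  qed auto
qed

lemma CE_square_diff_le:
  assumes A: "in_L2 M A" "A \<in> borel_measurable F" and B: "in_L2 M B"
    and E: "E \<in> borel_measurable M" "AE x in M. E x = A x - B x"
  shows "AE x in M. CE (\<lambda>y. (E y)\<^sup>2) x \<le> 2 * (A x)\<^sup>2 + 2 * CE (\<lambda>y. (B y)\<^sup>2) x"
proof -
  have [measurable]: "A \<in> borel_measurable M" "B \<in> borel_measurable M" "E \<in> borel_measurable M"
    using A B E by (auto simp: in_L2_def)
  have A2: "integrable M (\<lambda>x. 2 * (A x)\<^sup>2)" and B2: "integrable M (\<lambda>x. (B x)\<^sup>2)"
    and AB: "integrable M (\<lambda>x. (A x - B x)\<^sup>2)"
    using A B in_L2_diff[OF A(1) B] by (auto simp: in_L2_def)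
  have "AE x in M. CE (\<lambda>y. (E y)\<^sup>2) x = CE (\<lambda>y. (A y - B y)\<^sup>2) x"
    using E(2) by (intro real_cond_exp_cong) auto
  moreover have "AE x in M. CE (\<lambda>y. (A y - B y)\<^sup>2) x \<le> CE (\<lambda>y. 2 * (A y)\<^sup>2 + 2 * (B y)\<^sup>2) x"
    by (rule real_cond_exp_mono[OF _ AB]) (use A2 B2 in \<open>auto simp: power2_diff_le\<close>)
  moreover have "AE x in M. CE (\<lambda>y. 2 * (A y)\<^sup>2 + 2 * (B y)\<^sup>2) x = CE (\<lambda>y. 2 * (A y)\<^sup>2) x + CE (\<lambda>y. 2 * (B y)\<^sup>2) x"
    using A2 B2 by (intro real_cond_exp_add) auto
  moreover have "AE x in M. CE (\<lambda>y. 2 * (A y)\<^sup>2) x = 2 * (A x)\<^sup>2"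
    using A(2) A2 by (intro real_cond_exp_F_meas) auto
  moreover have "AE x in M. CE (\<lambda>y. 2 * (B y)\<^sup>2) x = 2 * CE (\<lambda>y. (B y)\<^sup>2) x"
    using B2 by (rule real_cond_exp_cmult)
  ultimately show ?thesis
    by eventually_elim linarith
qed

text \<open>
  The error is \<open>A - B\<close> with \<open>A\<close> the sum of the \<open>a\<^sub>m\<close> and \<open>B\<close> the martingale built from the tails \<open>R\<^sub>k\<close>. Its conditional
  second moment is at most \<open>2 A\<^sup>2\<close> plus twice that of \<open>B\<close>; these are the sequences \<open>U\<close> and \<open>V\<close> of the proof,
  up to the factor \<open>n\<close>.
\<close>

lemma
  fixes X D :: "'a \<Rightarrow> real" and p :: "nat \<Rightarrow> 'a \<Rightarrow> real"
  assumes X: "in_L2 M X" "X \<in> borel_measurable F"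
    and sum: "summable (\<lambda>k. (L2_norm M (CE (\<lambda>y. X ((T ^^ k) y))))\<^sup>2)"
    and p: "\<And>k. p k \<in> borel_measurable F"
    and p_T: "\<And>k. AE x in M. p k (T x) = CE (\<lambda>y. X ((T ^^ k) y)) (T x) - CE (\<lambda>y. X ((T ^^ Suc k) y)) x"
    and D: "L2_sums M p D" "D \<in> borel_measurable F"
    and dom: "\<And>e. 0 < e \<Longrightarrow> \<exists>N h. integrable M h \<and> (\<forall>x. 0 \<le> h x) \<and> (\<integral>x. h x \<partial>M) \<le> e \<and>
                (\<forall>k\<ge>N. AE x in M. (D x - (\<Sum>j<k. p j x))\<^sup>2 \<le> h x)"
  defines "err \<equiv> \<lambda>n y. (\<Sum>k=1..n. X ((T ^^ k) y)) - (\<Sum>k=1..n. D ((T ^^ k) y))"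
  shows martingale_approximation_mds: "AE x in M. CE (\<lambda>y. D (T y)) x = 0"
    and martingale_approximation_AE: "AE x in M. (\<lambda>n. 1 / real n * CE (\<lambda>y. (err n y)\<^sup>2) x) \<longlonglongrightarrow> 0"
    and martingale_approximation_L1: "(\<lambda>n. \<integral>x. \<bar>1 / real n * CE (\<lambda>y. (err n y)\<^sup>2) x\<bar> \<partial>M) \<longlonglongrightarrow> 0"
proof -
  define a where "a k = CE (\<lambda>y. X ((T ^^ k) y))" for k
  define R where "R k x = D x - (\<Sum>j<k. p j x)" for k x
  have p_L2: "in_L2 M (p k)" and D_L2: "in_L2 M D" for k
    using D(1) by (auto simp: L2_sums_def)
  have a_L2: "in_L2 M (a k)" for k
    unfolding a_def by (intro in_L2_CE in_L2_iter X)
  have a_F: "a k \<in> borel_measurable F" for k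
    by (simp add: a_def)
  have R_L2: "in_L2 M (R k)" for k
    unfolding R_def by (intro in_L2_diff in_L2_sum p_L2 D_L2)
  have R_F [measurable]: "R k \<in> borel_measurable F" for k
    unfolding R_def using p D(2) by measurable
  have p_mds: "AE x in M. CE (\<lambda>y. p k (T y)) x = 0" for k
    using in_L2_integrable[OF X(1)] F_measurable_imp_M[OF p] p_T by (rule increments_CE_zero)
  show "AE x in M. CE (\<lambda>y. D (T y)) x = 0"
    using D(1) p_mds by (rule L2_sum_CE_zero)
  have R_mds: "AE x in M. CE (\<lambda>y. R k (T y)) x = 0" for k
  proof (rule L2_sum_CE_zero)
    show "L2_sums M (\<lambda>i. p (k + i)) (R k)"
      unfolding R_def using D(1) by (rule L2_sums_tail)
  qed (rule p_mds)
  have R_sq: "integrable M (\<lambda>x. (R k x)\<^sup>2)" for k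
    using R_L2 by (simp add: in_L2_def)
  define A where "A n x = (\<Sum>m=1..n. a m x)" for n x
  define B where "B n y = (\<Sum>i=1..n. R (n + 1 - i) ((T ^^ i) y))" for n y
  have err_eq: "AE x in M. err n x = A n x - B n x" for n
  proof -
    have "AE x in M. \<forall>i k. p k (T ((T ^^ i) x)) = a k (T ((T ^^ i) x)) - a (Suc k) ((T ^^ i) x)"
      unfolding AE_all_countable
      by (intro allI AE_iter[of "\<lambda>x. p k (T x) = a k (T x) - a (Suc k) x" for k]) (rule p_T[folded a_def])
    moreover have "AE x in M. a 0 x = X x"
      unfolding a_def using X in_L2_integrable[OF X(1)] by (auto intro: real_cond_exp_F_meas)
    then have "AE x in M. \<forall>i. a 0 ((T ^^ i) x) = X ((T ^^ i) x)"
      unfolding AE_all_countable by (intro allI AE_iter[of "\<lambda>x. a 0 x = X x"])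
    ultimately show ?thesis
    proof eventually_elim
      case (elim x)
      have "(\<Sum>m=1..n. a 0 ((T ^^ m) x)) = (\<Sum>m=1..n. a m ((T ^^ 0) x)) + (\<Sum>i=1..n. \<Sum>j<n + 1 - i. p j ((T ^^ i) x))"
        using elim(1) by (intro triangular_telescoping) simp
      moreover have "B n x = (\<Sum>i=1..n. D ((T ^^ i) x)) - (\<Sum>i=1..n. \<Sum>j<n + 1 - i. p j ((T ^^ i) x))"
        unfolding B_def R_def by (rule sum_subtractf)
      ultimately show ?case
        using elim(2) by (simp add: err_def A_def)
    qed
  qed
  have err_L2: "in_L2 M (err n)" for n
    unfolding err_def by (intro in_L2_diff in_L2_sum in_L2_iter X(1) D_L2)
  have A_L2: "in_L2 M (A n)" for n
    unfolding A_def by (intro in_L2_sum a_L2)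
  have A_F: "A n \<in> borel_measurable F" for n
    unfolding A_def using a_F by measurable
  have B_L2: "in_L2 M (B n)" for n
    unfolding B_def by (intro in_L2_sum in_L2_iter R_L2)
  have err_meas [measurable]: "err n \<in> borel_measurable M" for n
    using err_L2 by (auto simp: in_L2_def)
  define U where "U n x = 1 / real n * (A n x)\<^sup>2" for n x
  define V where "V n x = 1 / real n * (\<Sum>i=1..n. CE (\<lambda>y. (R (n + 1 - i) ((T ^^ i) y))\<^sup>2) x)" for n x
  let ?Z = "\<lambda>n x. 1 / real n * CE (\<lambda>y. (err n y)\<^sup>2) x"
  have Z_le: "AE x in M. 0 \<le> ?Z n x \<and> ?Z n x \<le> 2 * U n x + 2 * V n x" for n
  proof -
    have "AE x in M. CE (\<lambda>y. (err n y)\<^sup>2) x \<le> 2 * (A n x)\<^sup>2 + 2 * CE (\<lambda>y. (B n y)\<^sup>2) x"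
      using A_L2 A_F B_L2 err_meas err_eq by (rule CE_square_diff_le)
    moreover have "AE x in M. CE (\<lambda>y. (B n y)\<^sup>2) x = (\<Sum>i=1..n. CE (\<lambda>y. (R (n + 1 - i) ((T ^^ i) y))\<^sup>2) x)"
      unfolding B_def by (rule CE_martingale_square[OF R_L2 R_F R_mds])
    moreover have "AE x in M. 0 \<le> CE (\<lambda>y. (err n y)\<^sup>2) x"
      by (rule real_cond_exp_pos) auto
    ultimately show ?thesis
    proof eventually_elim
      case (elim x)
      have "?Z n x \<le> 1 / real n * (2 * (A n x)\<^sup>2 + 2 * (\<Sum>i=1..n. CE (\<lambda>y. (R (n + 1 - i) ((T ^^ i) y))\<^sup>2) x))"
        using elim by (intro mult_left_mono) auto
      then show ?case
        using elim(3) by (simp add: U_def V_def distrib_left mult.left_commute)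
    qed
  qed
  have U: "AE x in M. (\<lambda>n. U n x) \<longlonglongrightarrow> 0" "(\<lambda>n. \<integral>x. U n x \<partial>M) \<longlonglongrightarrow> 0"
    unfolding U_def A_def
    using square_sum_Cesaro_AE_L1[of M a, OF a_L2] sum by (simp_all add: a_def)
  have V: "AE x in M. (\<lambda>n. V n x) \<longlonglongrightarrow> 0" "(\<lambda>n. \<integral>x. V n x \<partial>M) \<longlonglongrightarrow> 0"
    unfolding V_def
    by (rule cesaro_CE_AE[of "\<lambda>k x. (R k x)\<^sup>2", OF R_sq zero_le_power2 dom[folded R_def]]
        cesaro_CE_L1[of "\<lambda>k x. (R k x)\<^sup>2", OF R_sq zero_le_power2 dom[folded R_def]]; assumption)+
  have "AE x in M. \<forall>n. 0 \<le> ?Z n x \<and> ?Z n x \<le> 2 * U n x + 2 * V n x"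
    unfolding AE_all_countable using Z_le by blast
  then show "AE x in M. (\<lambda>n. ?Z n x) \<longlonglongrightarrow> 0"
    using U(1) V(1)
  proof eventually_elim
    case (elim x)
    have "(\<lambda>n. 2 * U n x + 2 * V n x) \<longlonglongrightarrow> 2 * 0 + 2 * 0"
      using elim by (intro tendsto_intros)
    then have "(\<lambda>n. 2 * U n x + 2 * V n x) \<longlonglongrightarrow> 0"
      by simp
    then show ?case
      by (rule tendsto_sandwich[OF _ _ tendsto_const, rotated 2])
        (rule always_eventually, use elim(1) in blast)+
  qed
  have U_int: "integrable M (U n)" for n
    using A_L2[of n] unfolding U_def in_L2_def by (intro integrable_mult_right) auto
  have V_int: "integrable M (V n)" for n
    unfolding V_def
    by (intro integrable_mult_right Bochner_Integration.integrable_sum real_cond_exp_int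
        integrable_iter[of "\<lambda>y. (R k y)\<^sup>2" for k] R_sq)
  have Z_int: "integrable M (?Z n)" for n
    using err_L2[of n] unfolding in_L2_def by (intro integrable_mult_right real_cond_exp_int) auto
  show "(\<lambda>n. \<integral>x. \<bar>?Z n x\<bar> \<partial>M) \<longlonglongrightarrow> 0"
  proof (rule tendsto_sandwich[OF _ _ tendsto_const])
    have "(\<lambda>n. 2 * (\<integral>x. U n x \<partial>M) + 2 * (\<integral>x. V n x \<partial>M)) \<longlonglongrightarrow> 2 * 0 + 2 * 0"
      using U(2) V(2) by (intro tendsto_intros)
    then show "(\<lambda>n. 2 * (\<integral>x. U n x \<partial>M) + 2 * (\<integral>x. V n x \<partial>M)) \<longlonglongrightarrow> 0"
      by simp
    have "(\<integral>x. \<bar>?Z n x\<bar> \<partial>M) \<le> 2 * (\<integral>x. U n x \<partial>M) + 2 * (\<integral>x. V n x \<partial>M)" for n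
    proof -
      have "AE x in M. \<bar>?Z n x\<bar> \<le> 2 * U n x + 2 * V n x"
        using Z_le[of n] by eventually_elim linarith
      then have "(\<integral>x. \<bar>?Z n x\<bar> \<partial>M) \<le> (\<integral>x. 2 * U n x + 2 * V n x \<partial>M)"
        using U_int V_int by (intro integral_mono_AE integrable_abs Z_int) auto
      then show ?thesis
        using U_int V_int by simp
    qed
    then show "\<forall>\<^sub>F n in sequentially. (\<integral>x. \<bar>?Z n x\<bar> \<partial>M) \<le> 2 * (\<integral>x. U n x \<partial>M) + 2 * (\<integral>x. V n x \<partial>M)"
      by simp
  qed simp
qed

text \<open>
  Orthogonality of the increments together with invariance of the measure.
\<close>

lemma integral_martingale_square:
  assumes d: "in_L2 M d" "d \<in> borel_measurable F" "AE x in M. CE (\<lambda>y. d (T y)) x = 0"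
  shows "(\<integral>y. (\<Sum>i=1..n. d ((T ^^ i) y))\<^sup>2 \<partial>M) = real n * (\<integral>y. (d y)\<^sup>2 \<partial>M)"
proof -
  have sq: "integrable M (\<lambda>y. (d y)\<^sup>2)" and [measurable]: "d \<in> borel_measurable M"
    using d by (auto simp: in_L2_def)
  have sq': "integrable M (\<lambda>y. (d ((T ^^ i) y))\<^sup>2)" for i
    using sq by (rule integrable_iter)
  have sum: "integrable M (\<lambda>y. (\<Sum>i=1..n. d ((T ^^ i) y))\<^sup>2)"
    using in_L2_sum[of "{1..n}" M "\<lambda>i y. d ((T ^^ i) y)"] in_L2_iter[OF d(1)] by (simp add: in_L2_def)
  have "(\<integral>y. (\<Sum>i=1..n. d ((T ^^ i) y))\<^sup>2 \<partial>M) = (\<integral>x. CE (\<lambda>y. (\<Sum>i=1..n. d ((T ^^ i) y))\<^sup>2) x \<partial>M)"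
    using real_cond_exp_int(2)[OF sum] by simp
  also have "\<dots> = (\<integral>x. (\<Sum>i=1..n. CE (\<lambda>y. (d ((T ^^ i) y))\<^sup>2) x) \<partial>M)"
    using CE_martingale_square[of "\<lambda>i. d"] d by (intro integral_cong_AE) auto
  also have "\<dots> = (\<Sum>i=1..n. \<integral>x. CE (\<lambda>y. (d ((T ^^ i) y))\<^sup>2) x \<partial>M)"
    by (intro Bochner_Integration.integral_sum real_cond_exp_int sq')
  also have "\<dots> = (\<Sum>i=1..n. \<integral>y. (d y)\<^sup>2 \<partial>M)"
  proof (rule sum.cong)
    fix i
    have "(\<integral>x. CE (\<lambda>y. (d ((T ^^ i) y))\<^sup>2) x \<partial>M) = (\<integral>y. (d ((T ^^ i) y))\<^sup>2 \<partial>M)"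
      by (rule real_cond_exp_int[OF sq'])
    also have "\<dots> = (\<integral>y. (d y)\<^sup>2 \<partial>M)"
      by (rule integral_iter) measurable
    finally show "(\<integral>x. CE (\<lambda>y. (d ((T ^^ i) y))\<^sup>2) x \<partial>M) = (\<integral>y. (d y)\<^sup>2 \<partial>M)" .
  qed simp
  finally show ?thesis
    by simp
qed

text \<open>
  The martingale with increments \<open>D - D'\<close> is the difference of the two errors, so its second moment is \<open>o(n)\<close>. It
  also equals \<open>n\<close> times the second moment of \<open>D - D'\<close>, which must therefore vanish.
\<close>

lemma martingale_approximation_unique:
  fixes S :: "nat \<Rightarrow> 'a \<Rightarrow> real"
  assumes S: "\<And>n. in_L2 M (S n)"
    and D: "in_L2 M D" "D \<in> borel_measurable F" "AE x in M. CE (\<lambda>y. D (T y)) x = 0"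
    and D': "in_L2 M D'" "D' \<in> borel_measurable F" "AE x in M. CE (\<lambda>y. D' (T y)) x = 0"
    and err: "(\<lambda>n. \<integral>x. \<bar>1 / real n * CE (\<lambda>y. (S n y - (\<Sum>k=1..n. D ((T ^^ k) y)))\<^sup>2) x\<bar> \<partial>M) \<longlonglongrightarrow> 0"
    and err': "(\<lambda>n. \<integral>x. \<bar>1 / real n * CE (\<lambda>y. (S n y - (\<Sum>k=1..n. D' ((T ^^ k) y)))\<^sup>2) x\<bar> \<partial>M) \<longlonglongrightarrow> 0"
  shows "AE x in M. D x = D' x"
proof -
  let ?d = "\<lambda>x. D x - D' x"
  let ?E = "\<lambda>D n y. S n y - (\<Sum>k=1..n. D ((T ^^ k) y))"
  let ?I = "\<lambda>D n. \<integral>x. \<bar>1 / real n * CE (\<lambda>y. (?E D n y)\<^sup>2) x\<bar> \<partial>M"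
  have d_L2: "in_L2 M ?d"
    using D D' by (intro in_L2_diff)
  have d_mds: "AE x in M. CE (\<lambda>y. ?d (T y)) x = 0"
  proof -
    have "AE x in M. CE (\<lambda>y. ?d (T y)) x = CE (\<lambda>y. D (T y)) x - CE (\<lambda>y. D' (T y)) x"
      by (intro real_cond_exp_diff integrable_T in_L2_integrable D D')
    then show ?thesis
      using D(3) D'(3) by eventually_elim simp
  qed
  have E_sq: "integrable M (\<lambda>y. (?E D n y)\<^sup>2)" if "in_L2 M D" for D n
  proof -
    have "in_L2 M (?E D n)"
      by (intro in_L2_diff in_L2_sum in_L2_iter S that)
    then show ?thesis
      by (simp add: in_L2_def)
  qed
  have mean: "(\<integral>y. (?E D n y)\<^sup>2 \<partial>M) \<le> real n * ?I D n" if "in_L2 M D" "n \<noteq> 0" for D n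
  proof -
    have "(\<integral>y. (?E D n y)\<^sup>2 \<partial>M) = (\<integral>x. CE (\<lambda>y. (?E D n y)\<^sup>2) x \<partial>M)"
      using real_cond_exp_int(2)[OF E_sq[OF that(1)]] by simp
    also have "\<dots> = real n * (\<integral>x. 1 / real n * CE (\<lambda>y. (?E D n y)\<^sup>2) x \<partial>M)"
      using that by simp
    also have "\<dots> \<le> real n * ?I D n"
      by (intro mult_left_mono integral_mono integrable_abs integrable_mult_right abs_ge_self of_nat_0_le_iff
          real_cond_exp_int E_sq that)
    finally show ?thesis .
  qed
  have "(\<integral>x. (?d x)\<^sup>2 \<partial>M) \<le> 2 * ?I D n + 2 * ?I D' n" if n: "n \<noteq> 0" for n
  proof -
    have "real n * (\<integral>x. (?d x)\<^sup>2 \<partial>M) = (\<integral>y. (\<Sum>i=1..n. ?d ((T ^^ i) y))\<^sup>2 \<partial>M)"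
      using D D' by (intro integral_martingale_square[symmetric] d_L2 d_mds) measurable
    also have "\<dots> \<le> (\<integral>y. 2 * (?E D n y)\<^sup>2 + 2 * (?E D' n y)\<^sup>2 \<partial>M)"
    proof (rule integral_mono)
      show "integrable M (\<lambda>y. (\<Sum>i=1..n. ?d ((T ^^ i) y))\<^sup>2)"
        using in_L2_sum[of "{1..n}" M "\<lambda>i y. ?d ((T ^^ i) y)"] in_L2_iter[OF d_L2] by (simp add: in_L2_def)
      show "integrable M (\<lambda>y. 2 * (?E D n y)\<^sup>2 + 2 * (?E D' n y)\<^sup>2)"
        using E_sq D D' by simp
      fix y
      have "(\<Sum>i=1..n. ?d ((T ^^ i) y)) = ?E D' n y - ?E D n y"
        by (simp add: sum_subtractf)
      then have "(\<Sum>i=1..n. ?d ((T ^^ i) y))\<^sup>2 = (?E D' n y - ?E D n y)\<^sup>2"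
        by (rule arg_cong)
      then show "(\<Sum>i=1..n. ?d ((T ^^ i) y))\<^sup>2 \<le> 2 * (?E D n y)\<^sup>2 + 2 * (?E D' n y)\<^sup>2"
        using power2_diff_le[of "?E D' n y" "?E D n y"] by linarith
    qed
    also have "\<dots> = 2 * (\<integral>y. (?E D n y)\<^sup>2 \<partial>M) + 2 * (\<integral>y. (?E D' n y)\<^sup>2 \<partial>M)"
      using E_sq D D' by simp
    also have "\<dots> \<le> 2 * (real n * ?I D n) + 2 * (real n * ?I D' n)"
      using n D D' by (intro add_mono mult_left_mono mean) auto
    also have "\<dots> = real n * (2 * ?I D n + 2 * ?I D' n)"
      by (simp add: distrib_left mult.left_commute)
    finally show ?thesis
      using n by (simp only: mult_le_cancel_left_pos of_nat_0_less_iff neq0_conv)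
  qed
  moreover have "(\<lambda>n. 2 * ?I D n + 2 * ?I D' n) \<longlonglongrightarrow> 2 * 0 + 2 * 0"
    using err err' by (intro tendsto_intros)
  ultimately have "(\<integral>x. (?d x)\<^sup>2 \<partial>M) \<le> 2 * 0 + 2 * 0"
    by (intro LIMSEQ_le_const) (auto intro: exI[of _ 1])
  moreover have "0 \<le> (\<integral>x. (?d x)\<^sup>2 \<partial>M)"
    by simp
  ultimately have "(\<integral>x. (?d x)\<^sup>2 \<partial>M) = 0"
    by linarith
  then have "AE x in M. (?d x)\<^sup>2 = 0"
    using d_L2 by (subst (asm) integral_nonneg_eq_0_iff_AE) (auto simp: in_L2_def)
  then show ?thesis
    by simp
qed

end

section \<open>The filtration of a bimeasurable bijection\<close>

lemma iter_int: "iter \<Omega> T (int k) = T ^^ k"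
  by (simp add: iter_def)

text \<open>
  Once the integral of the supremum is finite, the supremum is almost everywhere finite and serves as a real-valued
  dominating function.
\<close>

lemma dominating_function_of_SUP:
  fixes f :: "nat \<Rightarrow> 'a \<Rightarrow> real"
  assumes [measurable]: "\<And>k. f k \<in> borel_measurable M"
    and lim: "(\<lambda>N. \<integral>\<^sup>+x. (SUP k\<in>{N..}. ennreal (f k x)) \<partial>M) \<longlonglongrightarrow> 0"
    and "0 < e"
  shows "\<exists>N h. integrable M h \<and> (\<forall>x. 0 \<le> h x) \<and> (\<integral>x. h x \<partial>M) \<le> e \<and> (\<forall>k\<ge>N. AE x in M. f k x \<le> h x)"
proof -
  let ?G = "\<lambda>N x. SUP k\<in>{N..}. ennreal (f k x)"
  have "\<forall>\<^sub>F N in sequentially. (\<integral>\<^sup>+x. ?G N x \<partial>M) < ennreal e"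
    using \<open>0 < e\<close> by (intro order_tendstoD(2)[OF lim]) simp
  then obtain N where N: "(\<integral>\<^sup>+x. ?G N x \<partial>M) < ennreal e"
    by (auto simp: eventually_sequentially)
  define h where "h x = enn2real (?G N x)" for x
  have [measurable]: "h \<in> borel_measurable M"
    unfolding h_def by measurable
  have "AE x in M. ?G N x \<noteq> \<infinity>"
    using N by (intro nn_integral_PInf_AE) auto
  then have fin: "AE x in M. ennreal (h x) = ?G N x"
    unfolding h_def by eventually_elim (rule ennreal_enn2real, simp only: less_top infinity_ennreal_def)
  then have "(\<integral>\<^sup>+x. ennreal (h x) \<partial>M) = (\<integral>\<^sup>+x. ?G N x \<partial>M)"
    by (rule nn_integral_cong_AE)
  with N have nn: "(\<integral>\<^sup>+x. ennreal (h x) \<partial>M) < ennreal e"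
    by simp
  have h: "integrable M h"
    using nn by (intro integrableI_nonneg) (auto simp: h_def intro: less_trans)
  have h_nonneg: "0 \<le> h x" for x
    by (simp add: h_def)
  have "ennreal (\<integral>x. h x \<partial>M) < ennreal e"
    using nn nn_integral_eq_integral[OF h] h_nonneg by simp
  then have "(\<integral>x. h x \<partial>M) \<le> e"
    using h_nonneg by (simp add: ennreal_less_iff integral_nonneg)
  moreover have "AE x in M. f k x \<le> h x" if "N \<le> k" for k
    using fin
  proof eventually_elim
    case (elim x)
    have "ennreal (f k x) \<le> ennreal (h x)"
      unfolding elim using that by (intro SUP_upper) simp
    then show ?case
      by (simp add: h_def)
  qed
  ultimately show ?thesis
    using h by (intro exI[of _ N] exI[of _ h]) (auto simp: h_def)
qed

context
  fixes M F0 :: "'a measure" and T :: "'a \<Rightarrow> 'a"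
  assumes T: "bimeasurable_bij M T" and F0: "subalgebra M F0" and past: "sets F0 \<subseteq> sets (filt M T F0 1)"
begin

private lemma T_bij: "bij_betw T (space M) (space M)"
  using T by (simp add: bimeasurable_bij_def)

private lemma inv_T:
  "x \<in> space M \<Longrightarrow> the_inv_into (space M) T (T x) = x"
  "x \<in> space M \<Longrightarrow> T (the_inv_into (space M) T x) = x"
  "x \<in> space M \<Longrightarrow> T x \<in> space M"
  "x \<in> space M \<Longrightarrow> the_inv_into (space M) T x \<in> space M"
  using T_bij by (auto simp: bij_betw_def the_inv_into_f_f f_the_inv_into_f the_inv_into_into)

lemma filt_1_preimage:
  assumes "A \<in> sets F0"
  shows "\<exists>C\<in>sets F0. A = T -` C \<inter> space M"
proof -
  have "A \<in> sets (vimage_algebra (space M) T F0)"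
    using assms past by (auto simp: filt_def iter_def)
  then show ?thesis
    using F0 inv_T by (subst (asm) sets_vimage_algebra2) (auto simp: subalgebra_def)
qed

private lemma sets_filt_minus_1:
  "sets (filt M T F0 (- 1)) = {the_inv_into (space M) T -` A \<inter> space M |A. A \<in> sets F0}"
  unfolding filt_def using F0 inv_T by (subst sets_vimage_algebra2) (auto simp: iter_def subalgebra_def)

text \<open>
  A set of \<open>F\<^bsub>-1\<^esub>\<close> is an image \<open>T(A)\<close> with \<open>A\<close> in \<open>F\<^sub>0\<close>. Writing \<open>A = T\<^sup>-\<^sup>1 C\<close> with \<open>C\<close> in \<open>F\<^sub>0\<close> shows that it equals \<open>C\<close>.
\<close>

lemma subalgebra_filt_minus_1: "subalgebra F0 (filt M T F0 (- 1))"
proof -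
  have "the_inv_into (space M) T -` A \<inter> space M \<in> sets F0" if A: "A \<in> sets F0" for A
  proof -
    obtain C where C: "C \<in> sets F0" "A = T -` C \<inter> space M"
      using filt_1_preimage[OF A] by blast
    have "C \<subseteq> space M"
      using C(1) F0 sets.sets_into_space[of C F0] by (simp add: subalgebra_def)
    then have "the_inv_into (space M) T -` A \<inter> space M = C"
      unfolding C(2) using inv_T by auto
    then show ?thesis
      using C(1) by simp
  qed
  then show ?thesis
    using F0 unfolding subalgebra_def sets_filt_minus_1 by (auto simp: filt_def)
qed

text \<open>
  This lemma and the next one state that \<open>F\<^sub>0 = T\<^sup>-\<^sup>1 F\<^bsub>-1\<^esub>\<close>, the hypothesis of \<open>cond_exp_pullback\<close>.
\<close>

lemma filt_minus_1_preimage: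
  assumes A: "A \<in> sets F0"
  shows "\<exists>C\<in>sets (filt M T F0 (- 1)). A = T -` C \<inter> space M"
proof -
  have "A \<subseteq> space M"
    using A F0 sets.sets_into_space[of A F0] by (simp add: subalgebra_def)
  then have "A = T -` (the_inv_into (space M) T -` A \<inter> space M) \<inter> space M"
    using inv_T by auto
  then show ?thesis
    using A unfolding sets_filt_minus_1 by blast
qed

lemma T_measurable_filt_minus_1: "T \<in> F0 \<rightarrow>\<^sub>M filt M T F0 (- 1)"
proof (rule measurableI)
  fix x
  assume "x \<in> space F0"
  then show "T x \<in> space (filt M T F0 (- 1))"
    using F0 inv_T by (simp add: filt_def subalgebra_def)
next
  fix B
  assume "B \<in> sets (filt M T F0 (- 1))"
  then obtain A where A: "A \<in> sets F0" "B = the_inv_into (space M) T -` A \<inter> space M"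
    unfolding sets_filt_minus_1 by blast
  have "A \<subseteq> space M"
    using A F0 sets.sets_into_space[of A F0] by (simp add: subalgebra_def)
  then have "T -` B \<inter> space F0 = A"
    using A(2) inv_T F0 by (auto simp: subalgebra_def)
  then show "T -` B \<inter> space F0 \<in> sets F0"
    using A(1) by simp
qed

end

theorem proposition3p1:
  fixes M F0 :: "'a measure" and T :: "'a \<Rightarrow> 'a" and X0 :: "'a \<Rightarrow> real"
  defines "P \<equiv> \<lambda>k::nat. proj0 M T F0 (proc M T X0 (int k))"
  assumes "prob_space M"
    and "bimeasurable_bij M T"
    and "distr M M T = M"
    and "subalgebra M F0"
    and "sets F0 \<subseteq> sets (filt M T F0 1)"
    and "X0 \<in> borel_measurable F0"
    and "in_L2 M X0"
    and "(\<integral>x. X0 x \<partial>M) = 0"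
    and "summable (\<lambda>k::nat. (L2_norm M (real_cond_exp M F0 (proc M T X0 (int k))))\<^sup>2)"
    and "L2_summable M P"
    and "(\<lambda>N::nat. \<integral>\<^sup>+x. (SUP k\<in>{N..}. ennreal (\<bar>L2_suminf M (\<lambda>i. P (k + i)) x\<bar>\<^sup>2)) \<partial>M)
           \<longlonglongrightarrow> 0"
  shows "L2_0_MA M T F0 X0 \<and>
         (\<forall>D. is_L2_0_MA M T F0 X0 D \<longrightarrow> (AE x in M. D x = L2_suminf M P x))"
proof -
  note bij = assms(3) and F0 = assms(5) and filt = assms(6)
  interpret prob_space M
    by fact
  interpret filtered_dynamics M T F0
    using assms(3-5) filt_1_preimage[OF bij F0 filt] by unfold_locales (auto simp: bimeasurable_bij_def)
  let ?G = "filt M T F0 (- 1)"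
  have proc: "proc M T X0 (int k) = (\<lambda>y. X0 ((T ^^ k) y))" for k
    by (simp add: proc_def iter_int)
  have ma_error: "ma_error M T F0 X0 D =
      (\<lambda>n x. 1 / real n * CE (\<lambda>y. ((\<Sum>k=1..n. X0 ((T ^^ k) y)) - (\<Sum>k=1..n. D ((T ^^ k) y)))\<^sup>2) x)" for D
    by (simp add: ma_error_def proc iter_int fun_eq_iff)
  have X0_L2: "in_L2 M X0" and X0_F: "X0 \<in> borel_measurable F0"
    by fact+
  have sum: "summable (\<lambda>k. (L2_norm M (CE (\<lambda>y. X0 ((T ^^ k) y))))\<^sup>2)"
    using assms(10) by (simp add: proc)
  have P_eq: "P k x = CE (\<lambda>y. X0 ((T ^^ k) y)) x - real_cond_exp M ?G (\<lambda>y. X0 ((T ^^ k) y)) x" for k x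
    by (simp add: P_def proj0_def proc)
  have P_F: "P k \<in> borel_measurable F0" for k
    unfolding P_eq[abs_def]
    using measurable_from_subalg[OF subalgebra_filt_minus_1[OF bij F0 filt] borel_measurable_cond_exp]
    by (intro borel_measurable_diff) auto
  have G: "subalgebra M ?G"
    using subalgebra_filt_minus_1[OF bij F0 filt] F0 by (auto simp: subalgebra_def)
  have P_T: "AE x in M. P k (T x) = CE (\<lambda>y. X0 ((T ^^ k) y)) (T x) - CE (\<lambda>y. X0 ((T ^^ Suc k) y)) x" for k
  proof -
    have "AE x in M. CE (\<lambda>y. X0 ((T ^^ k) (T y))) x = real_cond_exp M ?G (\<lambda>y. X0 ((T ^^ k) y)) (T x)"
      by (rule cond_exp_pullback[OF G T_measurable_filt_minus_1[OF bij F0 filt] filt_minus_1_preimage[OF bij F0 filt]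
            integrable_iter[OF in_L2_integrable[OF X0_L2]]])
    then show ?thesis
      by eventually_elim (simp add: P_eq funpow_swap1)
  qed
  define s where "s = L2_suminf M P"
  have s: "L2_sums M P s"
    unfolding s_def by (rule L2_sums_L2_suminf) fact
  have s_int: "integrable M s" and P_int: "integrable M (P k)" for k
    using s by (auto simp: L2_sums_def in_L2_integrable)
  \<comment> \<open>The chosen sum \<open>s\<close> need not be measurable with respect to \<open>F0\<close>; conditioning supplies a version that is.\<close>
  define D where "D = CE s"
  have D_s: "AE x in M. D x = s x"
    unfolding D_def using F0 s_int
  proof (rule cond_exp_of_L1_limit)
    show "(\<lambda>n. \<integral>x. \<bar>(\<Sum>i<n. P i x) - s x\<bar> \<partial>M) \<longlonglongrightarrow> 0"
      using s by (rule L2_sums_imp_L1)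
  qed (use P_int P_F in auto)
  have D_F: "D \<in> borel_measurable F0"
    by (simp add: D_def)
  have D: "L2_sums M P D"
    using s F_measurable_imp_M[OF D_F] D_s by (rule L2_sums_cong_AE)
  have dom: "\<exists>N h. integrable M h \<and> (\<forall>x. 0 \<le> h x) \<and> (\<integral>x. h x \<partial>M) \<le> e \<and>
      (\<forall>k\<ge>N. AE x in M. (D x - (\<Sum>j<k. P j x))\<^sup>2 \<le> h x)" if e: "0 < e" for e
  proof -
    let ?t = "\<lambda>k. L2_suminf M (\<lambda>i. P (k + i))"
    have "?t k \<in> borel_measurable M" for k
    proof -
      have "L2_sums M (\<lambda>i. P (k + i)) (?t k)"
        using L2_sums_tail[OF D] by (intro L2_sums_L2_suminf) (auto simp: L2_summable_def)
      then show ?thesis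
        by (simp add: L2_sums_def in_L2_def)
    qed
    then have "(\<lambda>x. \<bar>?t k x\<bar>\<^sup>2) \<in> borel_measurable M" for k
      by measurable
    then obtain N h where h: "integrable M h" "\<forall>x. 0 \<le> h x" "(\<integral>x. h x \<partial>M) \<le> e"
        and th: "\<And>k. N \<le> k \<Longrightarrow> AE x in M. \<bar>?t k x\<bar>\<^sup>2 \<le> h x"
      using dominating_function_of_SUP[OF _ assms(12) e] by blast
    have "AE x in M. (D x - (\<Sum>j<k. P j x))\<^sup>2 \<le> h x" if "N \<le> k" for k
      using th[OF that] L2_suminf_tail_AE[OF D, of k] by eventually_elim simp
    then show ?thesis
      using h by blast
  qed
  note approx = martingale_approximation_mds[OF X0_L2 X0_F sum P_F P_T D D_F dom]
    martingale_approximation_AE[OF X0_L2 X0_F sum P_F P_T D D_F dom]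
    martingale_approximation_L1[OF X0_L2 X0_F sum P_F P_T D D_F dom]
  have D_MA: "is_L2_0_MA M T F0 X0 D"
    using approx D D_F unfolding is_L2_0_MA_def ma_error L2_sums_def by blast
  have "AE x in M. D' x = s x" if D': "is_L2_0_MA M T F0 X0 D'" for D'
  proof -
    have "AE x in M. D' x = D x"
    proof (rule martingale_approximation_unique[where S = "\<lambda>n y. \<Sum>k=1..n. X0 ((T ^^ k) y)"])
      show "in_L2 M (\<lambda>y. \<Sum>k=1..n. X0 ((T ^^ k) y))" for n
        by (intro in_L2_sum in_L2_iter X0_L2)
    qed (use D' D_MA in \<open>auto simp only: is_L2_0_MA_def ma_error\<close>)
    then show ?thesis
      using D_s by eventually_elim simp
  qed
  then show ?thesis
    using D_MA unfolding L2_0_MA_def s_def by blast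
qed

end
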